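(* There exist a countable group $G$ that is not finitely generated and not acylindrically hyperbolic, and an elementary embedding of the free group $F_2$ of rank $2$ into $G$.
   Context: An embedding $F_2\hookrightarrow G$ is elementary if for every first-order formula $\phi(\boldsymbol{x})$ in the language of groups and every tuple $\boldsymbol{h}$ of elements of $F_2$, $\phi(\boldsymbol{h})$ holds in $F_2$ if and only if $\phi$ holds in $G$ at the image of $\boldsymbol{h}$. Acylindrical action: an action of a group $G$ by isometries on a metric space $(X,d)$ is called acylindrical if for every $\varepsilon\geq 0$ there exist $N>0$ and $R>0$ such that for every two points $x,y\in X$ with $d(x,y)\geq R$ there are at most $N$ elements $g\in G$ such that $d(x,gx)\leq\varepsilon$ and $d(y,gy)\leq\varepsilon$. Loxodromic elements: let $G$ act by isometries on a $\delta$-hyperbolic (in the sense of Gromov, geodesic) metric space $(X,d)$. An element $g\in G$ is loxodromic if the map $\mathbb{Z}\to X$, $n\mapsto g^n x$, is a quasi-isometric embedding for some (equivalently, any) $x\in X$. A loxodromic element $g$ has exactly two limit points $g^{+\infty},g^{-\infty}$ on the Gromov boundary $\partial_\infty X$. Two loxodromic elements $g,h$ are independent if $\{g^{\pm\infty}\}$ and $\{h^{\pm\infty}\}$ are disjoint. Acylindrically hyperbolic: a group $G$ is acylindrically hyperbolic if it admits an acylindrical action by isometries on some $\delta$-hyperbolic metric space such that $G$ contains two independent loxodromic elements for this action. *)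

theory Defs
  imports "HOL-Algebra.Generated_Groups" "HOL-Algebra.Group_Action" "HOL-Analysis.Analysis"
begin

section \<open>Free groups\<close>

text \<open>The letter \<open>(a, True)\<close> stands for the generator \<open>a\<close>, and \<open>(a, False)\<close> for its inverse.\<close>

type_synonym 'a letter = "'a \<times> bool"

definition inv_letter :: "'a letter \<Rightarrow> 'a letter" where
  "inv_letter x = (fst x, \<not> snd x)"

definition reduced :: "'a letter list \<Rightarrow> bool" where
  "reduced w \<longleftrightarrow> successively (\<lambda>x y. y \<noteq> inv_letter x) w"

fun push_letter :: "'a letter \<Rightarrow> 'a letter list \<Rightarrow> 'a letter list" where
  "push_letter x [] = [x]"
| "push_letter x (y # w) = (if y = inv_letter x then w else x # y # w)"

definition free_group :: "'a set \<Rightarrow> 'a letter list monoid" where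
  "free_group S = \<lparr>carrier = {w. reduced w \<and> fst ` set w \<subseteq> S},
                   monoid.mult = (\<lambda>u v. foldr push_letter u v),
                   one = []\<rparr>"

lemma inv_letter_inv_letter [simp]: "inv_letter (inv_letter x) = x"
  by (simp add: inv_letter_def)

lemma fst_inv_letter [simp]: "fst (inv_letter x) = fst x"
  by (simp add: inv_letter_def)

lemma reduced_Nil [simp]: "reduced []"
  by (simp add: reduced_def)

lemma reduced_ConsD: "reduced (x # w) \<Longrightarrow> reduced w"
  by (cases w) (auto simp: reduced_def)

lemma reduced_push_letter: "reduced w \<Longrightarrow> reduced (push_letter x w)"
  by (cases w) (auto simp: reduced_def successively_Cons)

lemma reduced_foldr: "reduced v \<Longrightarrow> reduced (foldr push_letter u v)"
  by (induction u) (auto intro: reduced_push_letter)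

lemma set_push_letter: "set (push_letter x w) \<subseteq> insert x (set w)"
  by (cases w) auto

lemma set_foldr_push: "set (foldr push_letter u v) \<subseteq> set u \<union> set v"
  by (induction u) (use set_push_letter in fastforce)+

lemma push_letter_inverse: "reduced w \<Longrightarrow> push_letter x (push_letter (inv_letter x) w) = w"
  by (cases w rule: remdups_adj.cases) (auto simp: reduced_def)

lemma foldr_push_letter:
  assumes "reduced s" "reduced w"
  shows "foldr push_letter (push_letter x s) w = push_letter x (foldr push_letter s w)"
proof (cases s)
  case (Cons y t)
  have "reduced (foldr push_letter t w)"
    using assms by (intro reduced_foldr)
  then show ?thesis
    by (simp add: Cons push_letter_inverse)
qed auto

lemma foldr_push_assoc:
  assumes "reduced v" "reduced w"
  shows "foldr push_letter (foldr push_letter u v) w = foldr push_letter u (foldr push_letter v w)"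
  by (induction u) (auto simp: assms foldr_push_letter reduced_foldr)

lemma foldr_push_Nil: "reduced w \<Longrightarrow> foldr push_letter w [] = w"
proof (induction w)
  case (Cons x w)
  then show ?case
    using reduced_ConsD[OF Cons.prems] by (cases w) (auto simp: reduced_def)
qed auto

lemma foldr_push_inverse: "foldr push_letter (rev (map inv_letter w)) w = []"
  by (induction w) auto

lemma reduced_inverse: "reduced w \<Longrightarrow> reduced (rev (map inv_letter w))"
  unfolding reduced_def successively_rev successively_map
  by (erule successively_mono) (auto simp: inv_letter_def prod_eq_iff)

lemma group_free_group: "group (free_group S)"
proof (rule groupI)
  fix x y assume "x \<in> carrier (free_group S)" "y \<in> carrier (free_group S)"
  then show "x \<otimes>\<^bsub>free_group S\<^esub> y \<in> carrier (free_group S)"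
    using set_foldr_push[of x y] by (force simp: free_group_def reduced_foldr)
next
  fix x assume x: "x \<in> carrier (free_group S)"
  then have "rev (map inv_letter x) \<in> carrier (free_group S)"
    by (simp add: free_group_def reduced_inverse image_image)
  moreover have "rev (map inv_letter x) \<otimes>\<^bsub>free_group S\<^esub> x = \<one>\<^bsub>free_group S\<^esub>"
    by (simp add: free_group_def foldr_push_inverse)
  ultimately show "\<exists>y\<in>carrier (free_group S). y \<otimes>\<^bsub>free_group S\<^esub> x = \<one>\<^bsub>free_group S\<^esub>"
    by blast
qed (auto simp: free_group_def foldr_push_assoc)

definition free_group_2 :: "bool letter list monoid" where
  "free_group_2 = free_group UNIV"

definition finitely_generated :: "('g, 'm) monoid_scheme \<Rightarrow> bool" where
  "finitely_generated G \<longleftrightarrow> (\<exists>S. finite S \<and> S \<subseteq> carrier G \<and> generate G S = carrier G)"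


section \<open>First-order logic of groups\<close>

datatype gterm = TVar nat | TOne | TMult gterm gterm | TInv gterm

datatype gform = FEq gterm gterm | FNeg gform | FConj gform gform | FEx nat gform

primrec gterm_val :: "('g, 'm) monoid_scheme \<Rightarrow> (nat \<Rightarrow> 'g) \<Rightarrow> gterm \<Rightarrow> 'g" where
  "gterm_val G e (TVar i) = e i"
| "gterm_val G e TOne = \<one>\<^bsub>G\<^esub>"
| "gterm_val G e (TMult s t) = gterm_val G e s \<otimes>\<^bsub>G\<^esub> gterm_val G e t"
| "gterm_val G e (TInv t) = inv\<^bsub>G\<^esub> (gterm_val G e t)"

primrec holds :: "('g, 'm) monoid_scheme \<Rightarrow> (nat \<Rightarrow> 'g) \<Rightarrow> gform \<Rightarrow> bool" where
  "holds G e (FEq s t) \<longleftrightarrow> gterm_val G e s = gterm_val G e t"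
| "holds G e (FNeg \<phi>) \<longleftrightarrow> \<not> holds G e \<phi>"
| "holds G e (FConj \<phi> \<psi>) \<longleftrightarrow> holds G e \<phi> \<and> holds G e \<psi>"
| "holds G e (FEx i \<phi>) \<longleftrightarrow> (\<exists>a\<in>carrier G. holds G (e(i := a)) \<phi>)"

text \<open>A tuple of parameters is given by an assignment \<open>e\<close> of group elements to all variables, of
  which only the finitely many free variables of \<open>\<phi>\<close> matter.\<close>

definition elementary_embedding ::
    "('g, 'm) monoid_scheme \<Rightarrow> ('h, 'n) monoid_scheme \<Rightarrow> ('g \<Rightarrow> 'h) \<Rightarrow> bool" where
  "elementary_embedding F G f \<longleftrightarrow>
     f \<in> mon F G \<and>
     (\<forall>\<phi> e. range e \<subseteq> carrier F \<longrightarrow> (holds F e \<phi> \<longleftrightarrow> holds G (f \<circ> e) \<phi>))"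


section \<open>Gromov hyperbolic spaces and their boundary\<close>

definition geodesic_space :: "'x set \<Rightarrow> ('x \<Rightarrow> 'x \<Rightarrow> real) \<Rightarrow> bool" where
  "geodesic_space X d \<longleftrightarrow>
     (\<forall>x\<in>X. \<forall>y\<in>X. \<exists>\<gamma>. \<gamma> 0 = x \<and> \<gamma> (d x y) = y \<and> \<gamma> ` {0..d x y} \<subseteq> X \<and>
        (\<forall>s\<in>{0..d x y}. \<forall>t\<in>{0..d x y}. d (\<gamma> s) (\<gamma> t) = \<bar>s - t\<bar>))"

definition gromov_product :: "('x \<Rightarrow> 'x \<Rightarrow> real) \<Rightarrow> 'x \<Rightarrow> 'x \<Rightarrow> 'x \<Rightarrow> real" where
  "gromov_product d p x y = (d x p + d y p - d x y) / 2"

definition gromov_hyperbolic :: "'x set \<Rightarrow> ('x \<Rightarrow> 'x \<Rightarrow> real) \<Rightarrow> real \<Rightarrow> bool" where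
  "gromov_hyperbolic X d \<delta> \<longleftrightarrow>
     (\<forall>p\<in>X. \<forall>x\<in>X. \<forall>y\<in>X. \<forall>z\<in>X.
        gromov_product d p x z \<ge> min (gromov_product d p x y) (gromov_product d p y z) - \<delta>)"

definition hyperbolic_space :: "'x set \<Rightarrow> ('x \<Rightarrow> 'x \<Rightarrow> real) \<Rightarrow> bool" where
  "hyperbolic_space X d \<longleftrightarrow>
     Metric_space X d \<and> geodesic_space X d \<and> (\<exists>\<delta>\<ge>0. gromov_hyperbolic X d \<delta>)"

text \<open>\<open>gromov_asymptotic X d u v\<close> for \<open>u = v\<close> says that \<open>u\<close> converges to infinity.\<close>

definition gromov_asymptotic ::
    "'x set \<Rightarrow> ('x \<Rightarrow> 'x \<Rightarrow> real) \<Rightarrow> (nat \<Rightarrow> 'x) \<Rightarrow> (nat \<Rightarrow> 'x) \<Rightarrow> bool" where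
  "gromov_asymptotic X d u v \<longleftrightarrow>
     (\<forall>p\<in>X. filterlim (\<lambda>(m, n). gromov_product d p (u m) (v n)) at_top
              (sequentially \<times>\<^sub>F sequentially))"

definition seqs_to_infinity :: "'x set \<Rightarrow> ('x \<Rightarrow> 'x \<Rightarrow> real) \<Rightarrow> (nat \<Rightarrow> 'x) set" where
  "seqs_to_infinity X d = {u. range u \<subseteq> X \<and> gromov_asymptotic X d u u}"

definition boundary_rel ::
    "'x set \<Rightarrow> ('x \<Rightarrow> 'x \<Rightarrow> real) \<Rightarrow> ((nat \<Rightarrow> 'x) \<times> (nat \<Rightarrow> 'x)) set" where
  "boundary_rel X d =
     {(u, v). u \<in> seqs_to_infinity X d \<and> v \<in> seqs_to_infinity X d \<and> gromov_asymptotic X d u v}"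

definition gromov_boundary :: "'x set \<Rightarrow> ('x \<Rightarrow> 'x \<Rightarrow> real) \<Rightarrow> (nat \<Rightarrow> 'x) set set" where
  "gromov_boundary X d = seqs_to_infinity X d // boundary_rel X d"


section \<open>Acylindrically hyperbolic groups\<close>

definition isometric_action ::
    "('g, 'm) monoid_scheme \<Rightarrow> 'x set \<Rightarrow> ('x \<Rightarrow> 'x \<Rightarrow> real) \<Rightarrow> ('g \<Rightarrow> 'x \<Rightarrow> 'x) \<Rightarrow> bool" where
  "isometric_action G X d \<phi> \<longleftrightarrow>
     group_action G X \<phi> \<and>
     (\<forall>g\<in>carrier G. \<forall>x\<in>X. \<forall>y\<in>X. d (\<phi> g x) (\<phi> g y) = d x y)"

definition acylindrical_action ::
    "('g, 'm) monoid_scheme \<Rightarrow> 'x set \<Rightarrow> ('x \<Rightarrow> 'x \<Rightarrow> real) \<Rightarrow> ('g \<Rightarrow> 'x \<Rightarrow> 'x) \<Rightarrow> bool" where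
  "acylindrical_action G X d \<phi> \<longleftrightarrow>
     isometric_action G X d \<phi> \<and>
     (\<forall>\<epsilon>\<ge>0. \<exists>N>0. \<exists>R>0. \<forall>x\<in>X. \<forall>y\<in>X. d x y \<ge> R \<longrightarrow>
        finite {g \<in> carrier G. d x (\<phi> g x) \<le> \<epsilon> \<and> d y (\<phi> g y) \<le> \<epsilon>} \<and>
        card {g \<in> carrier G. d x (\<phi> g x) \<le> \<epsilon> \<and> d y (\<phi> g y) \<le> \<epsilon>} \<le> N)"

definition quasi_isometric_embedding ::
    "'a set \<Rightarrow> ('a \<Rightarrow> 'a \<Rightarrow> real) \<Rightarrow> 'x set \<Rightarrow> ('x \<Rightarrow> 'x \<Rightarrow> real) \<Rightarrow> ('a \<Rightarrow> 'x) \<Rightarrow> bool" where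
  "quasi_isometric_embedding A dA X d f \<longleftrightarrow>
     f ` A \<subseteq> X \<and>
     (\<exists>K\<ge>1. \<exists>C\<ge>0. \<forall>a\<in>A. \<forall>b\<in>A.
        dA a b / K - C \<le> d (f a) (f b) \<and> d (f a) (f b) \<le> K * dA a b + C)"

definition loxodromic ::
    "('g, 'm) monoid_scheme \<Rightarrow> 'x set \<Rightarrow> ('x \<Rightarrow> 'x \<Rightarrow> real) \<Rightarrow> ('g \<Rightarrow> 'x \<Rightarrow> 'x) \<Rightarrow> 'g \<Rightarrow> bool" where
  "loxodromic G X d \<phi> g \<longleftrightarrow>
     g \<in> carrier G \<and>
     (\<exists>x\<in>X. quasi_isometric_embedding (UNIV :: int set) (\<lambda>m n. of_int \<bar>m - n\<bar>) X d
              (\<lambda>n. \<phi> (g [^]\<^bsub>G\<^esub> n) x))"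

text \<open>For loxodromic \<open>g\<close> this is the set consisting of the two limits of \<open>g\<^sup>n x\<close> for \<open>n\<close> tending to
  plus and minus infinity; they do not depend on \<open>x\<close>.\<close>

definition limit_points ::
    "('g, 'm) monoid_scheme \<Rightarrow> 'x set \<Rightarrow> ('x \<Rightarrow> 'x \<Rightarrow> real) \<Rightarrow> ('g \<Rightarrow> 'x \<Rightarrow> 'x) \<Rightarrow> 'g
      \<Rightarrow> (nat \<Rightarrow> 'x) set set" where
  "limit_points G X d \<phi> g =
     {\<xi> \<in> gromov_boundary X d. \<exists>x\<in>X.
        (\<lambda>n. \<phi> (g [^]\<^bsub>G\<^esub> int n) x) \<in> \<xi> \<or> (\<lambda>n. \<phi> (g [^]\<^bsub>G\<^esub> (- int n)) x) \<in> \<xi>}"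

definition acylindrically_hyperbolic_action ::
    "('g, 'm) monoid_scheme \<Rightarrow> 'x set \<Rightarrow> ('x \<Rightarrow> 'x \<Rightarrow> real) \<Rightarrow> ('g \<Rightarrow> 'x \<Rightarrow> 'x) \<Rightarrow> bool" where
  "acylindrically_hyperbolic_action G X d \<phi> \<longleftrightarrow>
     hyperbolic_space X d \<and> acylindrical_action G X d \<phi> \<and>
     (\<exists>g h. loxodromic G X d \<phi> g \<and> loxodromic G X d \<phi> h \<and>
        limit_points G X d \<phi> g \<inter> limit_points G X d \<phi> h = {})"

text \<open>HOL cannot quantify over the type of the points of the space.  Spaces on subsets of
  \<open>'g \<times> real\<close> suffice: by \<open>acylindrically_hyperbolicI\<close> below, a group on \<open>'g\<close> with a suitable
  action on a space over an arbitrary type is acylindrically hyperbolic in this sense.\<close>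

definition acylindrically_hyperbolic :: "('g, 'm) monoid_scheme \<Rightarrow> bool" where
  "acylindrically_hyperbolic G \<longleftrightarrow>
     (\<exists>(X :: ('g \<times> real) set) d \<phi>. acylindrically_hyperbolic_action G X d \<phi>)"


subsection \<open>Independence of the type of points\<close>

text \<open>Pulling an action back along a bijection \<open>k\<close> from \<open>Z\<close> onto an invariant geodesic
  subspace.\<close>

lemma acylindrically_hyperbolic_action_pullback:
  fixes G :: "('g, 'm) monoid_scheme" (structure)
    and X :: "'x set" and Z :: "'z set" and k :: "'z \<Rightarrow> 'x"
  assumes hyp: "hyperbolic_space X d" and acyl: "acylindrical_action G X d \<phi>"
    and inj: "inj_on k Z" and sub: "k ` Z \<subseteq> X"
    and inv: "\<And>g z. g \<in> carrier G \<Longrightarrow> z \<in> Z \<Longrightarrow> \<phi> g (k z) \<in> k ` Z"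
    and geod: "geodesic_space (k ` Z) d"
    and lox: "loxodromic G (k ` Z) d \<phi> g" "loxodromic G (k ` Z) d \<phi> h"
    and indep: "limit_points G X d \<phi> g \<inter> limit_points G X d \<phi> h = {}"
  shows "\<exists>d' \<phi>'. acylindrically_hyperbolic_action G Z d' \<phi>'"
proof -
  define j where "j = inv_into Z k"
  define D where "D = (\<lambda>a b. if a \<in> Z \<and> b \<in> Z then d (k a) (k b) else 0)"
  define \<Phi> where "\<Phi> = (\<lambda>g. \<lambda>z\<in>Z. j (\<phi> g (k z)))"
  have jk: "j (k z) = z" if "z \<in> Z" for z
    using that inj by (simp add: j_def)
  have kj: "k (j y) = y" "j y \<in> Z" if "y \<in> k ` Z" for y
    using that by (auto simp: j_def f_inv_into_f inv_into_into)
  have kX: "k z \<in> X" if "z \<in> Z" for z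
    using that sub by auto
  have DD: "D a b = d (k a) (k b)" if "a \<in> Z" "b \<in> Z" for a b
    using that by (simp add: D_def)
  have kPhi: "k (\<Phi> g z) = \<phi> g (k z)" and PhiZ: "\<Phi> g z \<in> Z"
    if "g \<in> carrier G" "z \<in> Z" for g z
    using that inv[OF that] by (auto simp: \<Phi>_def kj)
  interpret M: Metric_space X d
    using hyp by (simp add: hyperbolic_space_def)
  interpret act: group_action G X \<phi>
    using acyl by (simp add: acylindrical_action_def isometric_action_def)
  interpret group G
    using act.group_hom by (simp add: group_hom_def)
  have isom: "d (\<phi> g x) (\<phi> g y) = d x y" if "g \<in> carrier G" "x \<in> X" "y \<in> X" for g x y
    using acyl that by (simp add: acylindrical_action_def isometric_action_def)

  have metric: "Metric_space Z D"
  proof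
    show "0 \<le> D x y" "D x y = D y x" for x y
      by (auto simp: D_def M.commute)
    show "D x y = 0 \<longleftrightarrow> x = y" if "x \<in> Z" "y \<in> Z" for x y
      using that inj by (auto simp: DD kX inj_on_eq_iff)
    show "D x z \<le> D x y + D y z" if "x \<in> Z" "y \<in> Z" "z \<in> Z" for x y z
      using that by (simp add: DD kX M.triangle)
  qed
  have gp: "gromov_product D p x y = gromov_product d (k p) (k x) (k y)"
    if "p \<in> Z" "x \<in> Z" "y \<in> Z" for p x y
    using that by (simp add: gromov_product_def DD)
  have hypZ: "hyperbolic_space Z D"
    unfolding hyperbolic_space_def
  proof (intro conjI metric)
    show "\<exists>\<delta>\<ge>0. gromov_hyperbolic Z D \<delta>"
    proof -
      obtain \<delta> where \<delta>: "\<delta> \<ge> 0" "gromov_hyperbolic X d \<delta>"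
        using hyp by (auto simp: hyperbolic_space_def)
      then have "gromov_hyperbolic Z D \<delta>"
        unfolding gromov_hyperbolic_def by (simp add: gp kX)
      with \<delta> show ?thesis by blast
    qed
    show "geodesic_space Z D"
      unfolding geodesic_space_def
    proof (intro ballI)
      fix x y assume xy: "x \<in> Z" "y \<in> Z"
      then obtain c where c: "c 0 = k x" "c (d (k x) (k y)) = k y"
          "c ` {0..d (k x) (k y)} \<subseteq> k ` Z"
          "\<And>s t. s \<in> {0..d (k x) (k y)} \<Longrightarrow> t \<in> {0..d (k x) (k y)} \<Longrightarrow> d (c s) (c t) = \<bar>s - t\<bar>"
        using geod unfolding geodesic_space_def by (metis imageI)
      have cZ: "c t \<in> k ` Z" if "t \<in> {0..d (k x) (k y)}" for t
        using c(3) that by blast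
      show "\<exists>\<gamma>. \<gamma> 0 = x \<and> \<gamma> (D x y) = y \<and> \<gamma> ` {0..D x y} \<subseteq> Z \<and>
             (\<forall>s\<in>{0..D x y}. \<forall>t\<in>{0..D x y}. D (\<gamma> s) (\<gamma> t) = \<bar>s - t\<bar>)"
      proof (intro exI[of _ "j \<circ> c"] conjI ballI)
        show "(j \<circ> c) ` {0..D x y} \<subseteq> Z"
          using cZ kj(2) by (auto simp: DD xy)
        show "D ((j \<circ> c) s) ((j \<circ> c) t) = \<bar>s - t\<bar>" if "s \<in> {0..D x y}" "t \<in> {0..D x y}" for s t
          using that c(4)[of s t] cZ[of s] cZ[of t] unfolding DD[OF xy] by (simp add: DD kj)
      qed (use xy c in \<open>simp_all add: DD jk\<close>)
    qed
  qed

  have actZ: "group_action G Z \<Phi>"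
    unfolding group_action_def group_hom_def group_hom_axioms_def
  proof (intro conjI group_BijGroup is_group homI)
    have comp: "\<Phi> (a \<otimes> b) z = \<Phi> a (\<Phi> b z)" if "a \<in> carrier G" "b \<in> carrier G" "z \<in> Z" for a b z
      using that by (simp add: \<Phi>_def kj inv kX act.composition_rule)
    have one: "\<Phi> \<one> z = z" if "z \<in> Z" for z
      using that by (simp add: \<Phi>_def kX jk flip: act.id_eq_one)
    have bij: "\<Phi> a \<in> Bij Z" if a: "a \<in> carrier G" for a
    proof -
      have "bij_betw (\<Phi> a) Z Z"
        by (rule bij_betw_byWitness[where f' = "\<Phi> (inv a)"])
          (use a PhiZ in \<open>auto simp: one simp flip: comp\<close>)
      then show ?thesis
        by (simp add: Bij_def \<Phi>_def)
    qed
    then show "\<Phi> a \<in> carrier (BijGroup Z)" if "a \<in> carrier G" for a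
      using that by (simp add: BijGroup_def)
    show "\<Phi> (a \<otimes> b) = \<Phi> a \<otimes>\<^bsub>BijGroup Z\<^esub> \<Phi> b" if ab: "a \<in> carrier G" "b \<in> carrier G" for a b
    proof -
      have "\<Phi> (a \<otimes> b) = compose Z (\<Phi> a) (\<Phi> b)"
      proof
        fix z show "\<Phi> (a \<otimes> b) z = compose Z (\<Phi> a) (\<Phi> b) z"
          using comp[OF ab, of z] by (cases "z \<in> Z") (simp_all add: compose_def \<Phi>_def)
      qed
      then show ?thesis
        using ab bij by (simp add: BijGroup_def)
    qed
  qed
  have isoZ: "isometric_action G Z D \<Phi>"
    unfolding isometric_action_def using actZ by (simp add: DD PhiZ kPhi isom kX)
  have acylZ: "acylindrical_action G Z D \<Phi>"
    unfolding acylindrical_action_def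
  proof (intro conjI isoZ allI impI)
    fix \<epsilon> :: real assume "\<epsilon> \<ge> 0"
    then obtain N R where NR: "N > 0" "R > 0" "\<And>x y. x \<in> X \<Longrightarrow> y \<in> X \<Longrightarrow> d x y \<ge> R \<Longrightarrow>
        finite {g \<in> carrier G. d x (\<phi> g x) \<le> \<epsilon> \<and> d y (\<phi> g y) \<le> \<epsilon>} \<and>
        card {g \<in> carrier G. d x (\<phi> g x) \<le> \<epsilon> \<and> d y (\<phi> g y) \<le> \<epsilon>} \<le> N"
      using acyl unfolding acylindrical_action_def by meson
    have "{g \<in> carrier G. D x (\<Phi> g x) \<le> \<epsilon> \<and> D y (\<Phi> g y) \<le> \<epsilon>} =
          {g \<in> carrier G. d (k x) (\<phi> g (k x)) \<le> \<epsilon> \<and> d (k y) (\<phi> g (k y)) \<le> \<epsilon>}"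
      if "x \<in> Z" "y \<in> Z" for x y
      using that by (auto simp: DD PhiZ kPhi)
    then show "\<exists>N>0. \<exists>R>0. \<forall>x\<in>Z. \<forall>y\<in>Z. D x y \<ge> R \<longrightarrow>
        finite {g \<in> carrier G. D x (\<Phi> g x) \<le> \<epsilon> \<and> D y (\<Phi> g y) \<le> \<epsilon>} \<and>
        card {g \<in> carrier G. D x (\<Phi> g x) \<le> \<epsilon> \<and> D y (\<Phi> g y) \<le> \<epsilon>} \<le> N"
      using NR by (intro exI[of _ N] exI[of _ R] conjI) (simp_all add: DD kX)
  qed
  have loxZ: "loxodromic G Z D \<Phi> a" if "loxodromic G (k ` Z) d \<phi> a" for a
  proof -
    from that have a: "a \<in> carrier G"
      unfolding loxodromic_def by (rule conjunct1)
    from that have "\<exists>y\<in>k ` Z. quasi_isometric_embedding (UNIV :: int set)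
        (\<lambda>m n. of_int \<bar>m - n\<bar>) (k ` Z) d (\<lambda>n. \<phi> (a [^] n) y)"
      unfolding loxodromic_def by (rule conjunct2)
    then obtain y where "y \<in> k ` Z"
      and y: "quasi_isometric_embedding (UNIV :: int set) (\<lambda>m n. of_int \<bar>m - n\<bar>) (k ` Z) d
              (\<lambda>n. \<phi> (a [^] n) y)"
      by (rule bexE)
    then obtain z where z: "z \<in> Z" and yz: "y = k z"
      by blast
    have PZ: "\<Phi> (a [^] n) z \<in> Z" and kP: "k (\<Phi> (a [^] n) z) = \<phi> (a [^] n) y" for n :: int
      using a z by (simp_all add: PhiZ kPhi yz)
    have "quasi_isometric_embedding (UNIV :: int set) (\<lambda>m n. of_int \<bar>m - n\<bar>) Z D
              (\<lambda>n. \<Phi> (a [^] n) z)"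
      using y PZ unfolding quasi_isometric_embedding_def by (simp add: DD kP image_subset_iff)
    then show ?thesis
      unfolding loxodromic_def using a z by (intro conjI bexI)
  qed

  have gp_base: "gromov_product d p x y \<le> gromov_product d q x y + d p q"
    if "p \<in> X" "q \<in> X" "x \<in> X" "y \<in> X" for p q x y
    using M.triangle[of x q p] M.triangle[of y q p] that
    by (simp add: gromov_product_def M.commute[of p q] field_simps)
  have asym: "gromov_asymptotic X d (k \<circ> u) (k \<circ> v)"
    if "range u \<subseteq> Z" "range v \<subseteq> Z" "gromov_asymptotic Z D u v" for u v
    unfolding gromov_asymptotic_def
  proof
    fix q assume q: "q \<in> X"
    have uv: "u m \<in> Z" "v m \<in> Z" for m
      using that by auto
    define p where "p = u 0"
    have p: "p \<in> Z" using uv by (simp add: p_def)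
    have lim: "filterlim (\<lambda>(m, n). gromov_product D p (u m) (v n)) at_top
              (sequentially \<times>\<^sub>F sequentially)"
      using that(3) p by (simp add: gromov_asymptotic_def)
    have "filterlim (\<lambda>x. - d (k p) q + (case x of (m, n) \<Rightarrow> gromov_product D p (u m) (v n))) at_top
              (sequentially \<times>\<^sub>F sequentially)"
      by (rule filterlim_tendsto_add_at_top[OF tendsto_const lim])
    then show "filterlim (\<lambda>(m, n). gromov_product d q ((k \<circ> u) m) ((k \<circ> v) n)) at_top
              (sequentially \<times>\<^sub>F sequentially)"
    proof (rule filterlim_at_top_mono, intro always_eventually allI)
      fix x :: "nat \<times> nat"
      obtain m n where x: "x = (m, n)" by (cases x)
      show "- d (k p) q + (case x of (m, n) \<Rightarrow> gromov_product D p (u m) (v n))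
          \<le> (case x of (m, n) \<Rightarrow> gromov_product d q ((k \<circ> u) m) ((k \<circ> v) n))"
        using gp_base[of "k p" q "k (u m)" "k (v n)"] q uv p by (simp add: x gp kX)
    qed
  qed
  have rel: "(k \<circ> u, k \<circ> v) \<in> boundary_rel X d" if "(u, v) \<in> boundary_rel Z D" for u v
  proof -
    have "range u \<subseteq> Z" "range v \<subseteq> Z" and uv: "gromov_asymptotic Z D u u" "gromov_asymptotic Z D v v"
        "gromov_asymptotic Z D u v"
      using that by (auto simp: boundary_rel_def seqs_to_infinity_def)
    then show ?thesis
      using asym[of u u] asym[of v v] asym[of u v] kX
      by (auto simp: boundary_rel_def seqs_to_infinity_def)
  qed
  have lim: "boundary_rel X d `` {k \<circ> u} \<in> limit_points G X d \<phi> a"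
    if a: "a \<in> carrier G" and u: "u \<in> seqs_to_infinity Z D"
      and lp: "boundary_rel Z D `` {u} \<in> limit_points G Z D \<Phi> a" for a u
  proof -
    have "(u, u) \<in> boundary_rel Z D"
      using u by (auto simp: boundary_rel_def seqs_to_infinity_def)
    from rel[OF this] have "k \<circ> u \<in> seqs_to_infinity X d"
      by (simp add: boundary_rel_def)
    then have 1: "boundary_rel X d `` {k \<circ> u} \<in> gromov_boundary X d"
      unfolding gromov_boundary_def by (rule quotientI)
    have eq: "k \<circ> (\<lambda>n. \<Phi> (a [^] f n) z) = (\<lambda>n. \<phi> (a [^] f n) (k z))"
      if "z \<in> Z" for z and f :: "nat \<Rightarrow> int"
      using that a by (auto simp: kPhi)
    obtain z where z: "z \<in> Z" and "(u, \<lambda>n. \<Phi> (a [^] int n) z) \<in> boundary_rel Z D \<or>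
        (u, \<lambda>n. \<Phi> (a [^] (- int n)) z) \<in> boundary_rel Z D"
      using lp by (auto simp: limit_points_def)
    then have "(k \<circ> u, \<lambda>n. \<phi> (a [^] int n) (k z)) \<in> boundary_rel X d \<or>
        (k \<circ> u, \<lambda>n. \<phi> (a [^] (- int n)) (k z)) \<in> boundary_rel X d"
      using rel eq[OF z, of int] eq[OF z, of "\<lambda>n. - int n"] by metis
    with 1 show ?thesis
      using kX[OF z] by (auto simp: limit_points_def)
  qed
  have "limit_points G Z D \<Phi> g \<inter> limit_points G Z D \<Phi> h = {}"
  proof (rule ccontr)
    assume "\<not> ?thesis"
    then obtain \<xi> where \<xi>: "\<xi> \<in> limit_points G Z D \<Phi> g" "\<xi> \<in> limit_points G Z D \<Phi> h"
      by blast
    then obtain u where "u \<in> seqs_to_infinity Z D" "\<xi> = boundary_rel Z D `` {u}"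
      by (auto simp: limit_points_def gromov_boundary_def elim: quotientE)
    with \<xi> lox indep lim[of g u] lim[of h u] show False
      by (auto simp: loxodromic_def)
  qed
  then show ?thesis
    using hypZ acylZ loxZ lox unfolding acylindrically_hyperbolic_action_def by blast
qed

lemma infinite_times_self_lepoll:
  assumes "infinite A" shows "A \<times> A \<lesssim> A"
  using card_of_Times_same_infinite[OF assms]
  by (simp add: eqpoll_iff_card_of_ordIso eqpoll_imp_lepoll)

theorem acylindrically_hyperbolicI:
  fixes G :: "('g, 'm) monoid_scheme" (structure) and X :: "'x set"
  assumes "acylindrically_hyperbolic_action G X d \<phi>"
  shows "acylindrically_hyperbolic G"
proof -
  from assms obtain g h where hyp: "hyperbolic_space X d" and acyl: "acylindrical_action G X d \<phi>"
      and lox: "loxodromic G X d \<phi> g" "loxodromic G X d \<phi> h"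
      and indep: "limit_points G X d \<phi> g \<inter> limit_points G X d \<phi> h = {}"
    by (auto simp: acylindrically_hyperbolic_action_def)
  interpret M: Metric_space X d
    using hyp by (simp add: hyperbolic_space_def)
  interpret act: group_action G X \<phi>
    using acyl by (simp add: acylindrical_action_def isometric_action_def)
  interpret group G
    using act.group_hom by (simp add: group_hom_def)
  have phiX: "\<phi> a x \<in> X" if "a \<in> carrier G" "x \<in> X" for a x
    using act.element_image that by blast
  have phi1: "\<phi> \<one> x = x" if "x \<in> X" for x
    using that by (simp flip: act.id_eq_one)
  obtain xg xh where x: "xg \<in> X" "xh \<in> X"
    and xg: "quasi_isometric_embedding (UNIV :: int set) (\<lambda>m n. of_int \<bar>m - n\<bar>) X d
              (\<lambda>n. \<phi> (g [^] n) xg)"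
    and xh: "quasi_isometric_embedding (UNIV :: int set) (\<lambda>m n. of_int \<bar>m - n\<bar>) X d
              (\<lambda>n. \<phi> (h [^] n) xh)"
    using lox by (auto simp: loxodromic_def)
  have gh: "g \<in> carrier G" "h \<in> carrier G"
    using lox by (auto simp: loxodromic_def)
  have "\<forall>x\<in>X. \<forall>y\<in>X. \<exists>c. c 0 = x \<and> c (d x y) = y \<and> c ` {0..d x y} \<subseteq> X \<and>
        (\<forall>s\<in>{0..d x y}. \<forall>t\<in>{0..d x y}. d (c s) (c t) = \<bar>s - t\<bar>)"
    using hyp by (simp add: hyperbolic_space_def geodesic_space_def)
  then obtain c where c: "\<And>x y. x \<in> X \<Longrightarrow> y \<in> X \<Longrightarrow>
        c x y 0 = x \<and> c x y (d x y) = y \<and> c x y ` {0..d x y} \<subseteq> X \<and>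
        (\<forall>s\<in>{0..d x y}. \<forall>t\<in>{0..d x y}. d (c x y s) (c x y t) = \<bar>s - t\<bar>)"
    by metis

  define F where "F = (\<lambda>A. {\<phi> a (c p q t) |a p q t. a \<in> carrier G \<and> p \<in> A \<and> q \<in> A \<and> t \<in> {0..d p q}})"
  define Y where "Y = rec_nat {\<phi> a y |a y. a \<in> carrier G \<and> y \<in> {xg, xh}} (\<lambda>_. F)"
  define W where "W = (\<Union>n. Y n)"
  have Y0: "Y 0 = {\<phi> a y |a y. a \<in> carrier G \<and> y \<in> {xg, xh}}" and YS: "Y (Suc n) = F (Y n)" for n
    by (simp_all add: Y_def)
  have YX: "Y n \<subseteq> X" for n
  proof (induction n)
    case 0
    then show ?case using x phiX by (auto simp: Y0)
  next
    case (Suc n)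
    have "c p q t \<in> X" if "p \<in> Y n" "q \<in> Y n" "t \<in> {0..d p q}" for p q t
      using c[of p q] that Suc by blast
    then show ?case
      using phiX by (auto simp: YS F_def)
  qed
  have WX: "W \<subseteq> X"
    using YX by (auto simp: W_def)
  have cY: "c p q t \<in> Y (Suc n)" if "p \<in> Y n" "q \<in> Y n" "t \<in> {0..d p q}" for p q t n
  proof -
    have "c p q t \<in> X"
      using c[of p q] that YX[of n] by blast
    then have "c p q t = \<phi> \<one> (c p q t)"
      by (simp add: phi1)
    with that show ?thesis
      unfolding YS F_def by blast
  qed
  have Ymono: "Y m \<subseteq> Y n" if "m \<le> n" for m n
  proof (rule lift_Suc_mono_le[OF _ that])
    show "Y n \<subseteq> Y (Suc n)" for n
    proof
      fix p assume p: "p \<in> Y n"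
      then have "p \<in> X" using YX by blast
      then show "p \<in> Y (Suc n)"
        using cY[OF p p, of 0] c[of p p] by simp
    qed
  qed
  have Yinv: "\<phi> a y \<in> Y n" if a: "a \<in> carrier G" and y: "y \<in> Y n" for a y n
  proof (cases n)
    case 0
    then obtain b z where b: "b \<in> carrier G" "z \<in> {xg, xh}" "y = \<phi> b z"
      using y by (auto simp: Y0)
    then have "\<phi> a y = \<phi> (a \<otimes> b) z"
      using x a act.composition_rule[of z a b] by auto
    then show ?thesis
      using b a unfolding 0 Y0 by blast
  next
    case (Suc m)
    then obtain b p q t where b: "b \<in> carrier G" "p \<in> Y m" "q \<in> Y m" "t \<in> {0..d p q}"
        "y = \<phi> b (c p q t)"
      using y by (auto simp: YS F_def)
    then have "c p q t \<in> X"
      using cY YX by blast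
    then have "\<phi> a y = \<phi> (a \<otimes> b) (c p q t)"
      using a b act.composition_rule[of "c p q t" a b] by auto
    moreover have "a \<otimes> b \<in> carrier G"
      using a b by simp
    ultimately show ?thesis
      using b(2-4) unfolding Suc YS F_def by blast
  qed
  have Winv: "\<phi> a y \<in> W" if "a \<in> carrier G" "y \<in> W" for a y
    using that Yinv by (auto simp: W_def)
  have geod: "geodesic_space W d"
    unfolding geodesic_space_def
  proof (intro ballI)
    fix p q assume pq: "p \<in> W" "q \<in> W"
    then obtain m n where "p \<in> Y m" "q \<in> Y n"
      by (auto simp: W_def)
    then have "p \<in> Y (max m n)" "q \<in> Y (max m n)"
      using Ymono[of m "max m n"] Ymono[of n "max m n"] by auto
    then have "c p q ` {0..d p q} \<subseteq> W"
      using cY unfolding W_def by blast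
    moreover have "p \<in> X" "q \<in> X"
      using pq WX by auto
    ultimately show "\<exists>\<gamma>. \<gamma> 0 = p \<and> \<gamma> (d p q) = q \<and> \<gamma> ` {0..d p q} \<subseteq> W \<and>
        (\<forall>s\<in>{0..d p q}. \<forall>t\<in>{0..d p q}. d (\<gamma> s) (\<gamma> t) = \<bar>s - t\<bar>)"
      using c[of p q] by blast
  qed
  have xW: "xg \<in> W" "xh \<in> W"
  proof -
    have "xg \<in> Y 0" "xh \<in> Y 0"
      unfolding Y0 using phi1[OF x(1), symmetric] phi1[OF x(2), symmetric] one_closed by blast+
    then show "xg \<in> W" "xh \<in> W"
      unfolding W_def by blast+
  qed
  have loxW: "loxodromic G W d \<phi> g" "loxodromic G W d \<phi> h"
  proof -
    have "quasi_isometric_embedding (UNIV :: int set) (\<lambda>m n. of_int \<bar>m - n\<bar>) W d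
              (\<lambda>n. \<phi> (g [^] n) xg)"
      using xg Winv[OF int_pow_closed[OF gh(1)] xW(1)]
      unfolding quasi_isometric_embedding_def by blast
    then show "loxodromic G W d \<phi> g"
      unfolding loxodromic_def using gh xW by (intro conjI bexI)
    have "quasi_isometric_embedding (UNIV :: int set) (\<lambda>m n. of_int \<bar>m - n\<bar>) W d
              (\<lambda>n. \<phi> (h [^] n) xh)"
      using xh Winv[OF int_pow_closed[OF gh(2)] xW(2)]
      unfolding quasi_isometric_embedding_def by blast
    then show "loxodromic G W d \<phi> h"
      unfolding loxodromic_def using gh xW by (intro conjI bexI)
  qed

  define U where "U = (UNIV :: ('g \<times> real) set)"
  have infU: "infinite U"
    by (simp add: U_def finite_prod infinite_UNIV_char_0)
  have UU: "U \<times> U \<lesssim> U"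
    by (rule infinite_times_self_lepoll[OF infU])
  have Ycard: "Y n \<lesssim> U" for n
  proof (induction n)
    case 0
    have "Y 0 \<subseteq> (\<lambda>(a, t). \<phi> a (if t = (0::real) then xg else xh)) ` U"
    proof
      fix y assume "y \<in> Y 0"
      then obtain a z where "y = \<phi> a z" "z \<in> {xg, xh}"
        by (auto simp: Y0)
      then show "y \<in> (\<lambda>(a, t). \<phi> a (if t = (0::real) then xg else xh)) ` U"
        by (auto simp: U_def image_iff intro: exI[of _ a] exI[of _ "0::real"] exI[of _ "1::real"])
    qed
    then show ?case
      by (rule subset_image_lepoll)
  next
    case (Suc n)
    have "Y (Suc n) \<subseteq> (\<lambda>((a, t), (p, q)). \<phi> a (c p q t)) ` (U \<times> (Y n \<times> Y n))"
    proof
      fix y assume "y \<in> Y (Suc n)"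
      then obtain a p q t where "y = \<phi> a (c p q t)" "p \<in> Y n" "q \<in> Y n"
        by (auto simp: YS F_def)
      then show "y \<in> (\<lambda>((a, t), (p, q)). \<phi> a (c p q t)) ` (U \<times> (Y n \<times> Y n))"
        by (intro image_eqI[of _ _ "((a, t), (p, q))"]) (auto simp: U_def)
    qed
    then have "Y (Suc n) \<lesssim> U \<times> (Y n \<times> Y n)"
      by (rule subset_image_lepoll)
    also have "\<dots> \<lesssim> U \<times> (U \<times> U)"
      by (intro times_lepoll_mono lepoll_refl Suc)
    also have "\<dots> \<lesssim> U \<times> U"
      by (intro times_lepoll_mono lepoll_refl UU)
    also have "\<dots> \<lesssim> U"
      by (rule UU)
    finally show ?case .
  qed
  have "\<forall>n. \<exists>f. Y n \<subseteq> f ` U"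
    using Ycard by (simp add: lepoll_iff)
  then obtain f where f: "\<And>n. Y n \<subseteq> f n ` U"
    by metis
  have "W \<subseteq> (\<lambda>(n, z). f n z) ` ((UNIV :: nat set) \<times> U)"
    using f by (force simp: W_def)
  then have "W \<lesssim> (UNIV :: nat set) \<times> U"
    by (rule subset_image_lepoll)
  also have "\<dots> \<lesssim> U \<times> U"
    using infU by (intro times_lepoll_mono lepoll_refl) (simp add: infinite_le_lepoll)
  also have "\<dots> \<lesssim> U"
    by (rule UU)
  finally obtain e :: "'x \<Rightarrow> 'g \<times> real" where e: "inj_on e W"
    unfolding lepoll_def by blast
  define Z where "Z = (e ` W :: ('g \<times> real) set)"
  define k where "k = inv_into W e"
  have kZ: "k ` Z = W" and injk: "inj_on k Z"
    using e by (auto simp: k_def Z_def inj_on_inv_into)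
  have "\<exists>d' \<phi>'. acylindrically_hyperbolic_action G Z d' \<phi>'"
  proof (rule acylindrically_hyperbolic_action_pullback[OF hyp acyl injk _ _ _ _ _ indep])
    show "\<phi> a (k z) \<in> k ` Z" if "a \<in> carrier G" "z \<in> Z" for a z
      using that kZ Winv by blast
  qed (use WX geod loxW in \<open>simp_all add: kZ\<close>)
  then show ?thesis
    unfolding acylindrically_hyperbolic_def by blast
qed

end

(*
  Call two commuting elements independent if no nontrivial power of one is a power of the other.
  If g is loxodromic for an acylindrical action and h commutes with g, then every h^j moves the orbit
  of g to a parallel quasi-geodesic, which by hyperbolicity is uniformly close to it.  Hence some
  h^j g^(-a(j)) moves all points of the orbit by at most a constant, and acylindricity makes two of
  these elements equal, so that g and h are not independent.  It is therefore enough to have an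
  elementary extension G of F_2 in which every nontrivial element has an independent partner.
  In an ultrapower of F_2, (x_n^n) is such a partner of (x_n).  G is a countable piece of a reduced
  power of F_2, formed by sequences closed under the group operations, Skolem functions, the partner
  operation, and an operation sending t_1, ..., t_r to a sequence whose n-th term is not a short word
  in the n-th terms of the t_i.  The last operation prevents finite generation.  As only countably
  many formulas with parameters matter, a diagonal subsequence replaces the ultrafilter.
*)
theory Submission
  imports Defs "HOL-Library.Diagonal_Subsequence"
begin

section \<open>Centralizers of loxodromic elements\<close>

text \<open>Iterated doubling bounds \<open>f n\<close> by \<open>f (2 ^ k * n) / 2 ^ k + c\<close>,
  and dividing \<open>2 ^ k * n\<close> by \<open>N = p + r\<close> with remainder bounds
  \<open>f (2 ^ k * n)\<close> through \<open>f N\<close>. As \<open>k\<close> grows the remainder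
  disappears, leaving \<open>f n\<close> at most \<open>n / N * f N + c\<close>; the bounds for
  \<open>p\<close> and \<open>r\<close> add up.\<close>

lemma subadditive_le_of_doubling:
  fixes f :: "nat \<Rightarrow> real"
  assumes sub: "\<And>p r. f (p + r) \<le> f p + f r" and c: "0 \<le> c"
    and nonneg: "\<And>n. 0 \<le> f n" and zero: "f 0 = 0"
    and dbl: "\<And>n. 2 * f n \<le> f (2 * n) + c"
  shows "f p + f r \<le> f (p + r) + 2 * c"
proof (cases "p + r = 0")
  case False
  define N where "N = p + r"
  have N: "N > 0" using False by (simp add: N_def)
  have mult: "f (s * n) \<le> s * f n" for s n
  proof (induction s)
    case (Suc s)
    then show ?case using sub[of n "s * n"] by (simp add: algebra_simps)
  qed (simp add: zero)
  have pow: "2 ^ k * f n \<le> f (2 ^ k * n) + (2 ^ k - 1) * c" for k n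
  proof (induction k)
    case (Suc k)
    then show ?case using dbl[of "2 ^ k * n"] by (simp add: algebra_simps)
  qed simp
  have lin: "f n \<le> n / N * f N + c" for n
  proof (rule field_le_epsilon)
    fix e :: real assume e: "e > 0"
    \<comment> \<open>With this \<open>k\<close>, the contribution \<open>N * f 1\<close> of the
      remainder is below \<open>e\<close> after division by \<open>2 ^ k\<close>.\<close>
    obtain k where k: "N * f 1 / e < 2 ^ k"
      using real_arch_pow[of 2] by auto
    define M where "M = 2 ^ k * n"
    have "f M \<le> f (M div N * N) + f (M mod N * 1)"
      using sub[of "M div N * N" "M mod N"] by simp
    also have "\<dots> \<le> (M div N) * f N + (M mod N) * f 1"
      by (intro add_mono mult)
    also have "\<dots> \<le> M / N * f N + N * f 1"
      using N nonneg
      by (intro add_mono mult_right_mono of_nat_div_le_of_nat) (auto intro: less_imp_le)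
    finally have "2 ^ k * f n \<le> 2 ^ k * n / N * f N + N * f 1 + (2 ^ k - 1) * c"
      using pow[of k n] by (simp add: M_def)
    also have "\<dots> \<le> 2 ^ k * n / N * f N + e * 2 ^ k + 2 ^ k * c"
      using k e c by (intro add_mono) (auto simp: field_simps)
    also have "\<dots> = 2 ^ k * (n / N * f N + c + e)"
      by (simp add: algebra_simps)
    finally show "f n \<le> n / N * f N + c + e"
      by simp
  qed
  have "f p + f r \<le> p / N * f N + c + (r / N * f N + c)"
    by (intro add_mono lin)
  also have "\<dots> = f N + 2 * c"
  proof -
    have "p / N + r / N = 1"
      using N by (simp add: N_def flip: add_divide_distrib of_nat_add)
    then have "p / N * f N + r / N * f N = f N"
      by (metis distrib_right mult_1)
    then show ?thesis by simp
  qed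
  finally show ?thesis by (simp add: N_def)
qed (use c zero in auto)

section \<open>Gromov products in hyperbolic spaces\<close>

lemma gromov_hyperbolic_four_point:
  assumes "gromov_hyperbolic X d \<delta>" "Metric_space X d" "w \<in> X" "x \<in> X" "y \<in> X" "z \<in> X"
  shows "d w x + d y z \<le> max (d w y + d x z) (d w z + d x y) + 2 * \<delta>"
proof -
  have "gromov_product d w y z \<ge> min (gromov_product d w y x) (gromov_product d w x z) - \<delta>"
    using assms by (auto simp: gromov_hyperbolic_def)
  then have "gromov_product d w y x - \<delta> \<le> gromov_product d w y z \<or>
      gromov_product d w x z - \<delta> \<le> gromov_product d w y z"
    by linarith
  moreover have "d y w = d w y" "d x w = d w x" "d z w = d w z" "d y x = d x y"
    using assms(2) by (auto intro: Metric_space.commute)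
  moreover have "2 * gromov_product d w a b = d a w + d b w - d a b" for a b
    by (simp add: gromov_product_def)
  note this[of y z] this[of y x] this[of x z]
  ultimately show ?thesis by linarith
qed

text \<open>Bisecting the chain applies the Gromov inequality along a tree of depth
  \<open>k\<close>, so the loss is \<open>k * \<delta>\<close>, logarithmic in the number of
  steps.\<close>

lemma gromov_product_chain:
  assumes hyp: "gromov_hyperbolic X d \<delta>" and w: "w \<in> X" and p: "\<And>i. p i \<in> X"
    and c: "\<And>i. i < 2 ^ k \<Longrightarrow> c \<le> gromov_product d w (p i) (p (Suc i))"
  shows "c - k * \<delta> \<le> gromov_product d w (p 0) (p (2 ^ k))"
  using p c
proof (induction k arbitrary: p)
  case (Suc k)
  have 1: "c - k * \<delta> \<le> gromov_product d w (p 0) (p (2 ^ k))"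
    using Suc.prems by (intro Suc.IH) auto
  have 2: "c - k * \<delta> \<le> gromov_product d w (p (2 ^ k + 0)) (p (2 ^ k + 2 ^ k))"
    using Suc.prems by (intro Suc.IH[of "\<lambda>i. p (2 ^ k + i)"]) auto
  have "gromov_product d w (p 0) (p (2 ^ k + 2 ^ k)) \<ge>
      min (gromov_product d w (p 0) (p (2 ^ k))) (gromov_product d w (p (2 ^ k)) (p (2 ^ k + 2 ^ k))) - \<delta>"
    using hyp w Suc.prems(1) by (auto simp: gromov_hyperbolic_def)
  then show ?case
    using 1 2 by (simp add: algebra_simps mult_2)
qed simp

text \<open>This fixes a stretch length \<open>2 ^ k\<close> for which linear growth in the length
  beats the loss \<open>k * \<delta>\<close> of \<open>gromov_product_chain\<close>.\<close>

lemma ex_linear_less_power: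
  fixes a b :: real
  shows "\<exists>k::nat. a + b * k < 2 ^ k"
proof -
  \<comment> \<open>The exponent will be \<open>2 * j\<close>: one factor \<open>2 ^ j\<close>
    absorbs the coefficients, the other absorbs \<open>1 + j\<close>.\<close>
  obtain j :: nat where j: "\<bar>a\<bar> + 2 * \<bar>b\<bar> < 2 ^ j"
    using real_arch_pow[of 2] by auto
  have "a + b * (2 * j) \<le> \<bar>a\<bar> * (1 + real j) + \<bar>b\<bar> * (2 * (1 + real j))"
  proof (rule add_mono)
    show "a \<le> \<bar>a\<bar> * (1 + real j)"
      using mult_left_mono[of 1 "1 + real j" "\<bar>a\<bar>"] by simp
    show "b * (2 * j) \<le> \<bar>b\<bar> * (2 * (1 + real j))"
      by (rule mult_mono) auto
  qed
  also have "\<dots> = (\<bar>a\<bar> + 2 * \<bar>b\<bar>) * (1 + real j)"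
    by (simp add: algebra_simps)
  also have "\<dots> < 2 ^ j * (1 + real j)"
    using j by (intro mult_strict_right_mono) auto
  also have "\<dots> \<le> 2 ^ j * (2 ^ j :: real)"
    using of_nat_mono[OF Suc_leI[OF less_exp[of j]], where 'a = real] by (intro mult_left_mono) auto
  finally show ?thesis
    unfolding power_add[symmetric] mult_2[symmetric] by (intro exI[of _ "2 * j"]) simp
qed

section \<open>Homogeneous quasi-geodesics and their parallels\<close>

text \<open>This abstracts the orbit of a loxodromic element: \<open>x i\<close> is the image of a
  base point under the \<open>i\<close>-th power. \<open>lower\<close> is the lower quasi-isometry
  bound; a linear upper bound follows from subadditivity (\<open>f_le\<close>).\<close>

locale hyperbolic_orbit = Metric_space X d
  for X :: "'x set" and d :: "'x \<Rightarrow> 'x \<Rightarrow> real" +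
  fixes \<delta> :: real and f :: "nat \<Rightarrow> real" and x :: "int \<Rightarrow> 'x" and K C :: real
  assumes hyp: "gromov_hyperbolic X d \<delta>" and \<delta>: "0 \<le> \<delta>"
    and x_in: "\<And>i. x i \<in> X" and d_x: "\<And>i j. d (x i) (x j) = f (nat \<bar>i - j\<bar>)"
    and K: "0 < K" and lower: "\<And>n. n / K - C \<le> f n"
begin

lemma d_x_le: "i \<le> j \<Longrightarrow> d (x i) (x j) = f (nat (j - i))"
  by (simp add: d_x abs_minus_commute)

lemma f_nonneg: "0 \<le> f n"
  using d_x[of 0 "int n"] nonneg[of "x 0" "x (int n)"] by simp

lemma f_0: "f 0 = 0"
  using d_x[of 0 0] x_in by simp

lemma f_add: "f (p + r) \<le> f p + f r"
  using triangle[of "x 0" "x (int p)" "x (int (p + r))"] x_in by (simp add: d_x nat_int_add add.commute)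

lemma f_le: "f n \<le> n * f 1"
proof (induction n)
  case (Suc n)
  then show ?case using f_add[of n 1] by (simp add: algebra_simps)
qed (simp add: f_0)

lemma f_unbounded: "\<exists>n>0. B < f n"
proof -
  obtain n :: nat where n: "K * (B + C) < n"
    using reals_Archimedean2 by blast
  then have "K * (B + C) < Suc n"
    by simp
  then have "B < Suc n / K - C"
    using K by (simp add: field_simps)
  then show ?thesis
    using lower[of "Suc n"] by (intro exI[of _ "Suc n"]) simp
qed

text \<open>If \<open>f\<close> were nearly constant on a stretch of length \<open>2 ^ k\<close>, the Gromov product at \<open>x 0\<close> of the two
  ends of the stretch would be close to \<open>f n\<close> up to an error linear in \<open>k\<close>; but it differs from \<open>f n\<close> by
  half the distance of the ends, which is at least linear in \<open>2 ^ k\<close>.\<close>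

lemma ex_jump: "\<exists>Q. \<forall>n. \<exists>q\<le>Q. \<delta> < \<bar>f (n + q) - f n\<bar>"
proof -
  obtain k :: nat where "K * (3 * \<delta> + f 1 + C) + 2 * \<delta> * K * k < 2 ^ k"
    using ex_linear_less_power by blast
  then have k: "3 * \<delta> + f 1 + 2 * k * \<delta> < 2 ^ k / K - C"
    using K by (simp add: less_diff_eq pos_less_divide_eq) (simp add: algebra_simps)
  show ?thesis
  proof (rule exI, rule allI, rule ccontr)
    fix n assume "\<not> (\<exists>q\<le>2 ^ k. \<delta> < \<bar>f (n + q) - f n\<bar>)"
    then have small: "\<bar>f (n + q) - f n\<bar> \<le> \<delta>" if "q \<le> 2 ^ k" for q
      using that by force
    define p where "p = (\<lambda>i. x (int (n + i)))"
    have gp: "gromov_product d (x 0) (p i) (p j) = (f (n + i) + f (n + j) - f (j - i)) / 2"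
      if "i \<le> j" for i j
      using that by (simp add: gromov_product_def p_def d_x nat_int_add add.commute nat_diff_distrib)
    have "f n - \<delta> - f 1 / 2 - k * \<delta> \<le> gromov_product d (x 0) (p 0) (p (2 ^ k))"
    proof (rule gromov_product_chain[OF hyp])
      fix i :: nat assume "i < 2 ^ k"
      then show "f n - \<delta> - f 1 / 2 \<le> gromov_product d (x 0) (p i) (p (Suc i))"
        using small[of i] small[of "Suc i"] by (simp add: gp)
    qed (auto simp: p_def x_in)
    also have "\<dots> \<le> f n + \<delta> / 2 - f (2 ^ k) / 2"
      using small[of "2 ^ k"] by (simp add: gp)
    finally show False
      using k lower[of "2 ^ k"] by simp
  qed
qed

text \<open>For the four orbit points \<open>0\<close>, \<open>n\<close>, \<open>n + q\<close>,
  \<open>2 * n + q\<close> the sums of opposite distances are \<open>2 * f n\<close>,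
  \<open>2 * f (n + q)\<close> and \<open>f (2 * n + q) + f q\<close>, and the two largest differ by
  at most \<open>2 * \<delta>\<close>. The jump from \<open>ex_jump\<close> separates the first two
  by more than that, so the third bounds both up to \<open>2 * \<delta>\<close>.\<close>

lemma f_doubling: "\<exists>c\<ge>0. \<forall>n. 2 * f n \<le> f (2 * n) + c"
proof -
  obtain Q where Q: "\<And>n. \<exists>q\<le>Q. \<delta> < \<bar>f (n + q) - f n\<bar>"
    using ex_jump by blast
  have "2 * f n \<le> f (2 * n) + (2 * Q * f 1 + 2 * \<delta>)" for n
  proof -
    obtain q where q: "q \<le> Q" "\<delta> < \<bar>f (n + q) - f n\<bar>"
      using Q by blast
    have four: "2 * f n \<le> max (2 * f (n + q)) (f (2 * n + q) + f q) + 2 * \<delta>"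
      "2 * f (n + q) \<le> max (2 * f n) (f (2 * n + q) + f q) + 2 * \<delta>"
      using gromov_hyperbolic_four_point[OF hyp Metric_space_axioms x_in x_in x_in x_in,
          of 0 "int n" "int (n + q)" "int (2 * n + q)"]
        gromov_hyperbolic_four_point[OF hyp Metric_space_axioms x_in x_in x_in x_in,
          of 0 "int (n + q)" "int n" "int (2 * n + q)"]
      by (simp_all add: d_x nat_add_distrib nat_mult_distrib algebra_simps)
    have "f q \<le> Q * f 1"
      using f_le[of q] q(1) f_nonneg[of 1] by (meson mult_right_mono of_nat_mono order_trans)
    then show ?thesis
      using four q(2) f_add[of "2 * n" q] by (auto simp: max_def abs_if split: if_splits)
  qed
  moreover have "0 \<le> 2 * Q * f 1 + 2 * \<delta>"
    using f_nonneg[of 1] \<delta> by simp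
  ultimately show ?thesis by blast
qed

lemma f_almost_additive: "\<exists>B\<ge>0. \<forall>p r. f p + f r \<le> f (p + r) + B"
proof -
  obtain c where "c \<ge> 0" "\<And>n. 2 * f n \<le> f (2 * n) + c"
    using f_doubling by blast
  then have "f p + f r \<le> f (p + r) + 2 * c" for p r
    by (intro subadditive_le_of_doubling f_add f_nonneg f_0)
  with \<open>c \<ge> 0\<close> show ?thesis
    by (intro exI[of _ "2 * c"]) auto
qed

text \<open>The point is that \<open>\<epsilon>\<close> does not depend on the distance between the two orbits.\<close>

lemma parallel_orbit_close:
  "\<exists>\<epsilon>\<ge>0. \<forall>y D. (\<forall>i. y i \<in> X) \<longrightarrow> (\<forall>i j. d (y i) (y j) = f (nat \<bar>i - j\<bar>)) \<longrightarrow>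
     (\<forall>i. d (x i) (y i) = D) \<longrightarrow> (\<exists>a. d (y 0) (x a) \<le> \<epsilon>)"
proof -
  obtain B where B: "B \<ge> 0" "\<And>p r. f p + f r \<le> f (p + r) + B"
    using f_almost_additive by blast
  define T where "T = B / 2 + 3 * \<delta>"
  have "\<exists>a. d (y 0) (x a) \<le> 2 * T + f 1 + B / 2"
    if y_in: "\<And>i. y i \<in> X" and d_y: "\<And>i j. d (y i) (y j) = f (nat \<bar>i - j\<bar>)"
      and D: "\<And>i. d (x i) (y i) = D" for y D
  proof -
    \<comment> \<open>\<open>D\<close> only governs how far out the orbits are cut off. Seen from
      \<open>y 0\<close>, the ends \<open>x (int n)\<close> and \<open>y (int n)\<close> then have
      Gromov product above \<open>T\<close>, and likewise at \<open>- int n\<close>.\<close>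
    obtain n where n: "D + T < f n"
      using f_unbounded by blast
    define gp where "gp = gromov_product d (y 0)"
    have gp: "gp u v = (d u (y 0) + d v (y 0) - d u v) / 2" for u v
      by (simp add: gp_def gromov_product_def)
    have min: "gp u w \<ge> min (gp u v) (gp v w) - \<delta>" if "u \<in> X" "v \<in> X" "w \<in> X" for u v w
      using hyp that y_in by (auto simp: gromov_hyperbolic_def gp_def)
    have far: "f n - D \<le> d (x i) (y 0)" if "\<bar>i\<bar> = int n" for i
      using triangle[of "y i" "x i" "y 0"] x_in y_in D[of i] d_y[of i 0] that
      by (simp add: commute)
    have near: "gp (x i) (y i) \<ge> f n - D" "gp (y i) (x i) \<ge> f n - D" if "\<bar>i\<bar> = int n" for i
      using far[OF that] d_y[of i 0] D[of i] commute[of "y i" "x i"] that by (auto simp: gp)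
    have "gp (y (- int n)) (y (int n)) \<le> B / 2"
      using B(2)[of n n] d_y[of "- int n" "int n"] d_y[of "- int n" 0] d_y[of "int n" 0]
      by (simp add: gp nat_mult_distrib flip: mult_2)
    \<comment> \<open>The products of neighbouring ends exceed \<open>T\<close>, so in each of the
      two Gromov inequalities the minimum is the other term; each inequality costs one
      \<open>\<delta>\<close>.\<close>
    then have ends: "gp (x (- int n)) (x (int n)) \<le> B / 2 + 2 * \<delta>"
      using min[OF y_in x_in y_in, of "- int n" "- int n" "int n"]
        min[OF x_in x_in y_in, of "- int n" "int n" "int n"]
        near[of "int n"] near[of "- int n"] n \<delta> B(1) by (simp add: T_def)
    \<comment> \<open>A discrete intermediate value argument: the product with the left end of the
      orbit falls from above \<open>T\<close> to at most \<open>T\<close> within a single step, and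
      the close point \<open>x a\<close> is taken just before this fall.\<close>
    define P where "P = (\<lambda>j. T < gp (x (- int n)) (x (- int n + int j)))"
    have "P 0"
      using far[of "- int n"] n x_in by (simp add: P_def gp)
    moreover have "\<not> P (2 * n)"
      using ends \<delta> by (simp add: P_def T_def)
    ultimately have "\<exists>j<2 * n. P j \<and> \<not> P (Suc j)"
      using dec_induct[of 0 "2 * n" P] by auto
    then obtain j where j: "j < 2 * n" "P j" "\<not> P (Suc j)"
      by blast
    define a where "a = - int n + int j"
    have a: "- int n \<le> a" "a \<le> int n"
      using j(1) by (auto simp: a_def)
    have 1: "gp (x a) (x (int n)) \<le> T"
      using min[OF x_in x_in x_in, of "- int n" a "int n"] ends j(2) by (simp add: P_def a_def T_def)
    have "d (x a) (y 0) \<le> f 1 + d (x (a + 1)) (y 0)"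
      "d (x (- int n)) (x (a + 1)) \<le> d (x (- int n)) (x a) + f 1"
      using triangle[of "x a" "x (a + 1)" "y 0"] triangle[of "x (- int n)" "x a" "x (a + 1)"]
        x_in y_in d_x[of a "a + 1"] by simp_all
    then have "gp (x (- int n)) (x a) \<le> gp (x (- int n)) (x (a + 1)) + f 1"
      unfolding gp by argo
    then have 2: "gp (x (- int n)) (x a) \<le> T + f 1"
      using j(3) by (simp add: P_def a_def algebra_simps)
    have "d (x (- int n)) (x a) + d (x a) (x (int n)) \<le> d (x (- int n)) (x (int n)) + B"
      using B(2)[of "nat (a + int n)" "nat (int n - a)"] a
      by (simp add: d_x_le flip: nat_add_distrib)
    moreover have "d (x (- int n)) (x (int n)) \<le> d (x (- int n)) (y 0) + d (x (int n)) (y 0)"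
      using triangle'[of "x (- int n)" "y 0" "x (int n)"] x_in y_in by (simp add: commute)
    \<comment> \<open>By the two preceding estimates, the products of \<open>x a\<close> with both
      ends add up to at least \<open>d (x a) (y 0) - B / 2\<close>.\<close>
    ultimately have "d (y 0) (x a) \<le> 2 * T + f 1 + B / 2"
      using 1 2 by (simp add: gp commute)
    then show ?thesis ..
  qed
  moreover have "0 \<le> 2 * T + f 1 + B / 2"
    using B(1) \<delta> f_nonneg[of 1] by (simp add: T_def)
  ultimately show ?thesis
    by (intro exI[of _ "2 * T + f 1 + B / 2"] conjI allI impI) simp_all
qed

end

section \<open>Elements commuting with a loxodromic element\<close>

lemma (in group) int_pow_commutes:
  assumes "x \<otimes> y = y \<otimes> x" and x: "x \<in> carrier G" and y: "y \<in> carrier G"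
  shows "x \<otimes> y [^] (i::int) = y [^] i \<otimes> x"
proof -
  have pow: "y [^] n \<otimes> x = x \<otimes> y [^] n" for n :: nat
    using assms by (intro group_commutes_pow) auto
  have "x \<otimes> inv (y [^] n) = inv (y [^] n) \<otimes> x" for n :: nat
  proof -
    have "y [^] n \<otimes> (x \<otimes> inv (y [^] n)) = y [^] n \<otimes> x \<otimes> inv (y [^] n)"
      using x y by (simp add: m_assoc)
    also have "\<dots> = x \<otimes> y [^] n \<otimes> inv (y [^] n)"
      by (simp only: pow)
    also have "\<dots> = x"
      using x y by (simp add: m_assoc)
    finally show ?thesis
      by (subst inv_solve_left) (use x y in simp_all)
  qed
  then show ?thesis
    using pow y by (cases i rule: int_cases2) (simp_all add: int_pow_int int_pow_neg_int)
qed

lemma (in group) centralizer_power_loxodromic: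
  assumes hyp: "hyperbolic_space X d" and acyl: "acylindrical_action G X d \<phi>"
    and lox: "loxodromic G X d \<phi> g"
    and h: "h \<in> carrier G" "h \<otimes> g = g \<otimes> h"
  shows "\<exists>m>0. \<exists>a::int. h [^] (m::nat) = g [^] a"
proof (rule ccontr)
  assume "\<not> ?thesis"
  then have indep: "\<And>m a. m > 0 \<Longrightarrow> h [^] (m::nat) \<noteq> g [^] (a::int)"
    by blast
  interpret M: Metric_space X d
    using hyp by (simp add: hyperbolic_space_def)
  interpret act: group_action G X \<phi>
    using acyl by (simp add: acylindrical_action_def isometric_action_def)
  have iso: "d (\<phi> a u) (\<phi> a v) = d u v" if "a \<in> carrier G" "u \<in> X" "v \<in> X" for a u v
    using acyl that by (simp add: acylindrical_action_def isometric_action_def)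
  have g: "g \<in> carrier G"
    using lox by (simp add: loxodromic_def)
  obtain \<delta> where \<delta>: "\<delta> \<ge> 0" "gromov_hyperbolic X d \<delta>"
    using hyp by (auto simp: hyperbolic_space_def)
  obtain z where z: "z \<in> X" and qi: "quasi_isometric_embedding UNIV
      (\<lambda>m n. real_of_int \<bar>m - n\<bar>) X d (\<lambda>n. \<phi> (g [^] (n::int)) z)"
    using lox unfolding loxodromic_def by blast
  then obtain K C where K: "K \<ge> 1"
    and lower: "\<And>i j. real_of_int \<bar>i - j\<bar> / K - C \<le> d (\<phi> (g [^] (i::int)) z) (\<phi> (g [^] (j::int)) z)"
    unfolding quasi_isometric_embedding_def by blast
  have actX: "\<phi> a u \<in> X" if "a \<in> carrier G" "u \<in> X" for a u
    using act.element_image that by blast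
  have act1: "\<phi> \<one> u = u" if "u \<in> X" for u
    using that by (simp flip: act.id_eq_one)
  have mult: "\<phi> (a \<otimes> b) u = \<phi> a (\<phi> b u)" if "a \<in> carrier G" "b \<in> carrier G" "u \<in> X" for a b u
    using that act.composition_rule by blast
  define x where "x = (\<lambda>i::int. \<phi> (g [^] i) z)"
  define f where "f = (\<lambda>n::nat. d z (x (int n)))"
  have x_in: "x i \<in> X" for i
    by (simp add: x_def actX g z)
  have shift: "x (i + j) = \<phi> (g [^] i) (x j)" for i j
    using g z by (simp add: x_def int_pow_mult mult)
  have d_le: "d (x i) (x j) = f (nat (j - i))" if "i \<le> j" for i j
  proof -
    have "d (x i) (x j) = d (\<phi> (g [^] i) z) (\<phi> (g [^] i) (x (j - i)))"
      using shift[of i "j - i"] by (simp add: x_def)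
    also have "\<dots> = d z (x (j - i))"
      using g z x_in by (intro iso) auto
    finally show ?thesis using that by (simp add: f_def)
  qed
  have d_x: "d (x i) (x j) = f (nat \<bar>i - j\<bar>)" for i j
    using d_le[of i j] d_le[of j i] M.commute[of "x i" "x j"] by (cases "i \<le> j") auto
  have "n / K - C \<le> f n" for n
    using lower[of 0 "int n"] act1[OF z] by (simp add: f_def x_def)
  then interpret hyperbolic_orbit X d \<delta> f x K C
    using \<delta> x_in d_x K by unfold_locales auto
  obtain \<epsilon> where \<epsilon>: "\<epsilon> \<ge> 0" and close: "\<And>y D. (\<And>i. y i \<in> X) \<Longrightarrow>
      (\<And>i j. d (y i) (y j) = f (nat \<bar>i - j\<bar>)) \<Longrightarrow> (\<And>i. d (x i) (y i) = D) \<Longrightarrow>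
      \<exists>a. d (y 0) (x a) \<le> \<epsilon>"
    using parallel_orbit_close by blast
  have comm: "h [^] (j::nat) \<otimes> g [^] (i::int) = g [^] i \<otimes> h [^] j" for i j
    by (rule int_pow_commutes[OF group_commutes_pow[OF h(2,1) g] nat_pow_closed[OF h(1)] g])
  have "\<exists>a::int. d (\<phi> (h [^] j) z) (x a) \<le> \<epsilon>" for j :: nat
  proof -
    define y where "y = (\<lambda>i. \<phi> (h [^] j) (x i))"
    have "\<exists>a. d (y 0) (x a) \<le> \<epsilon>"
    proof (rule close)
      show "y i \<in> X" for i
        by (simp add: y_def actX h x_in)
      show "d (y i) (y k) = f (nat \<bar>i - k\<bar>)" for i k
        using h x_in by (simp add: y_def iso d_x)
      \<comment> \<open>Commutation makes the translate of the orbit parallel to it. Its distance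
        may grow with \<open>j\<close>, but \<open>\<epsilon>\<close> stays the same.\<close>
      show "d (x i) (y i) = d z (\<phi> (h [^] j) z)" for i
      proof -
        have "y i = \<phi> (g [^] i) (\<phi> (h [^] j) z)"
          using g h z by (simp add: y_def x_def comm flip: mult)
        then show ?thesis
          using g h z by (simp add: x_def iso actX)
      qed
    qed
    then show ?thesis
      using act1[OF z] by (simp add: y_def x_def)
  qed
  then obtain a where a: "\<And>j::nat. d (\<phi> (h [^] j) z) (x (a j)) \<le> \<epsilon>"
    by metis
  define u where "u = (\<lambda>j::nat. h [^] j \<otimes> g [^] (- a j))"
  have u: "u j \<in> carrier G" for j
    using g h by (simp add: u_def)
  have u_move: "d (x i) (\<phi> (u j) (x i)) \<le> \<epsilon>" for i j
  proof -
    have "\<phi> (u j) (x i) = \<phi> (h [^] j) (\<phi> (g [^] (- a j)) (x i))"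
      unfolding u_def using g h x_in by (intro mult) auto
    also have "\<dots> = \<phi> (h [^] j) (\<phi> (g [^] (i - a j)) z)"
      using shift[of "- a j" i] by (simp add: x_def)
    also have "\<dots> = \<phi> (h [^] j \<otimes> g [^] (i - a j)) z"
      using g h z by (intro mult[symmetric]) auto
    also have "\<dots> = \<phi> (g [^] (i - a j)) (\<phi> (h [^] j) z)"
      unfolding comm using g h z by (intro mult) auto
    finally have "\<phi> (u j) (x i) = \<phi> (g [^] (i - a j)) (\<phi> (h [^] j) z)" .
    \<comment> \<open>Both \<open>x i\<close> and its image under \<open>u j\<close> are translates
      by \<open>g [^] (i - a j)\<close>, so the displacement is the same at every orbit
      point.\<close>
    moreover have "x i = \<phi> (g [^] (i - a j)) (x (a j))"
      using shift[of "i - a j" "a j"] by simp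
    ultimately have "d (\<phi> (u j) (x i)) (x i) = d (\<phi> (h [^] j) z) (x (a j))"
      using iso[of "g [^] (i - a j)" "\<phi> (h [^] j) z" "x (a j)"] g h z x_in actX by simp
    then show ?thesis
      using a[of j] M.commute[of "x i"] by simp
  qed
  \<comment> \<open>A coincidence \<open>u i = u j\<close> with \<open>i < j\<close> would make
    \<open>h [^] (j - i)\<close> a power of \<open>g\<close>.\<close>
  have "inj u"
  proof (rule linorder_injI)
    fix i j :: nat assume ij: "i < j"
    show "u i \<noteq> u j"
    proof
      assume eq: "u i = u j"
      have "h [^] i \<otimes> g [^] (- a i) = h [^] i \<otimes> h [^] (j - i) \<otimes> g [^] (- a j)"
        using eq ij nat_pow_mult[OF h(1), of i "j - i"] by (simp add: u_def)
      then have "g [^] (- a i) = h [^] (j - i) \<otimes> g [^] (- a j)"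
        using h g by (simp add: m_assoc)
      then have "g [^] (- a i) \<otimes> g [^] (a j) = h [^] (j - i) \<otimes> (g [^] (- a j) \<otimes> g [^] (a j))"
        using h g by (simp add: m_assoc)
      then have "g [^] (- a i + a j) = h [^] (j - i)"
        using h g int_pow_mult[OF g, of "- a j" "a j"] int_pow_mult[OF g, of "- a i" "a j"] by simp
      then show False
        using indep[of "j - i" "- a i + a j"] ij by simp
    qed
  qed
  obtain N R where "\<forall>u\<in>X. \<forall>v\<in>X. d u v \<ge> R \<longrightarrow>
      finite {g \<in> carrier G. d u (\<phi> g u) \<le> \<epsilon> \<and> d v (\<phi> g v) \<le> \<epsilon>} \<and>
      card {g \<in> carrier G. d u (\<phi> g u) \<le> \<epsilon> \<and> d v (\<phi> g v) \<le> \<epsilon>} \<le> N"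
    using acyl \<epsilon> unfolding acylindrical_action_def by blast
  then have N: "finite {g \<in> carrier G. d u (\<phi> g u) \<le> \<epsilon> \<and> d v (\<phi> g v) \<le> \<epsilon>}"
    if "u \<in> X" "v \<in> X" "d u v \<ge> R" for u v
    using that by blast
  obtain n where "R < f n"
    using f_unbounded by blast
  then have "d (x 0) (x (int n)) \<ge> R"
    by (simp add: d_x)
  then have "finite {k \<in> carrier G. d (x 0) (\<phi> k (x 0)) \<le> \<epsilon> \<and> d (x (int n)) (\<phi> k (x (int n))) \<le> \<epsilon>}"
    by (intro N x_in)
  moreover have "range u \<subseteq> {k \<in> carrier G. d (x 0) (\<phi> k (x 0)) \<le> \<epsilon> \<and> d (x (int n)) (\<phi> k (x (int n))) \<le> \<epsilon>}"
    using u u_move by auto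
  ultimately have "finite (range u)"
    by (rule rev_finite_subset)
  then show False
    using \<open>inj u\<close> by (simp add: finite_image_iff)
qed

text \<open>The powers of the identity give a constant orbit, for which the lower quasi-isometry
  bound would bound all natural numbers by \<open>K * C\<close>.\<close>

lemma loxodromic_neq_one:
  assumes "Metric_space X d" and "loxodromic G X d \<phi> g" and "group G"
  shows "g \<noteq> \<one>\<^bsub>G\<^esub>"
proof
  assume g: "g = \<one>\<^bsub>G\<^esub>"
  have pow: "g [^]\<^bsub>G\<^esub> i = \<one>\<^bsub>G\<^esub>" for i :: int
    using assms(3) by (simp add: g group.int_pow_one)
  obtain z where "quasi_isometric_embedding (UNIV :: int set) (\<lambda>m n. of_int \<bar>m - n\<bar>) X d
      (\<lambda>n. \<phi> (g [^]\<^bsub>G\<^esub> n) z)"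
    using assms(2) unfolding loxodromic_def by blast
  then obtain K C where K: "K \<ge> 1" and u: "\<phi> \<one>\<^bsub>G\<^esub> z \<in> X"
    and lower: "\<And>i j :: int. real_of_int \<bar>i - j\<bar> / K - C \<le> d (\<phi> \<one>\<^bsub>G\<^esub> z) (\<phi> \<one>\<^bsub>G\<^esub> z)"
    unfolding quasi_isometric_embedding_def pow by blast
  have "d (\<phi> \<one>\<^bsub>G\<^esub> z) (\<phi> \<one>\<^bsub>G\<^esub> z) = 0"
    using Metric_space.zero[OF assms(1) u u] by simp
  then have "real i \<le> K * C" for i :: nat
    using lower[of "int i" 0] K by (simp add: field_simps)
  then show False
    by (meson reals_Archimedean2 not_less)
qed

section \<open>A countable reduced power\<close>

text \<open>Each predicate becomes eventually constant on some subsequence, and a diagonal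
  subsequence serves all of them; \<open>U\<close> is the image of \<open>sequentially\<close> under
  it.\<close>

lemma ex_deciding_filter:
  fixes P :: "nat \<Rightarrow> nat \<Rightarrow> bool"
  shows "\<exists>U. U \<le> sequentially \<and> U \<noteq> bot \<and>
    (\<forall>k. eventually (P k) U \<or> eventually (\<lambda>n. \<not> P k n) U)"
proof -
  define D where "D = (\<lambda>k s. eventually (\<lambda>n. P k (s n)) sequentially \<or>
    eventually (\<lambda>n. \<not> P k (s n)) sequentially)"
  interpret subseqs D
  proof
    fix k and s :: "nat \<Rightarrow> nat"
    show "\<exists>r'. strict_mono r' \<and> D k (s \<circ> r')"
    proof (cases "infinite {n. P k (s n)}")
      case True
      then obtain r' :: "nat \<Rightarrow> nat" where "strict_mono r'" "\<forall>n. r' n \<in> {n. P k (s n)}"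
        using infinite_enumerate by blast
      then show ?thesis by (auto simp: D_def)
    next
      case False
      then have "eventually (\<lambda>n. \<not> P k (s n)) sequentially"
        by (simp add: frequently_cofinite flip: cofinite_eq_sequentially not_frequently)
      then show ?thesis
        by (intro exI[of _ id]) (auto simp: D_def strict_mono_def)
    qed
  qed
  have mono: "D k (s \<circ> r)" if "strict_mono r" "D k s" for r s k
    using that eventually_subseq[OF that(1)] by (auto simp: D_def)
  have "D k diagseq" for k
    \<comment> \<open>Only the tail of \<open>diagseq\<close> from \<open>Suc k\<close> on is known
      to refine the \<open>k\<close>-th subsequence, so the property of this tail is shifted
      back.\<close>
    using diagseq_holds[of k, OF mono]
      eventually_sequentially_seg[of "\<lambda>n. P k (diagseq n)" "Suc k"]
      eventually_sequentially_seg[of "\<lambda>n. \<not> P k (diagseq n)" "Suc k"]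
    by (simp add: D_def add.commute[of k])
  moreover have "filterlim diagseq sequentially sequentially"
    by (rule filterlim_subseq[OF subseq_diagseq])
  ultimately show ?thesis
    by (intro exI[of _ "filtermap diagseq sequentially"])
      (auto simp: filterlim_def D_def eventually_filtermap filtermap_bot_iff)
qed

section \<open>Finitely many variables matter\<close>

primrec term_bound :: "gterm \<Rightarrow> nat" where
  "term_bound (TVar i) = Suc i"
| "term_bound TOne = 0"
| "term_bound (TMult s t) = max (term_bound s) (term_bound t)"
| "term_bound (TInv t) = term_bound t"

text \<open>Quantified variables are not discounted. An upper bound suffices to replace an
  assignment by a finite list of parameters, as Skolem terms require.\<close>

primrec form_bound :: "gform \<Rightarrow> nat" where
  "form_bound (FEq s t) = max (term_bound s) (term_bound t)"
| "form_bound (FNeg \<phi>) = form_bound \<phi>"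
| "form_bound (FConj \<phi> \<psi>) = max (form_bound \<phi>) (form_bound \<psi>)"
| "form_bound (FEx i \<phi>) = form_bound \<phi>"

lemma gterm_val_cong:
  "(\<And>i. i < term_bound t \<Longrightarrow> e i = e' i) \<Longrightarrow> gterm_val G e t = gterm_val G e' t"
  by (induction t) auto

lemma holds_cong:
  "(\<And>i. i < form_bound \<phi> \<Longrightarrow> e i = e' i) \<Longrightarrow> holds G e \<phi> \<longleftrightarrow> holds G e' \<phi>"
proof (induction \<phi> arbitrary: e e')
  case (FEq s t)
  have "gterm_val G e s = gterm_val G e' s" "gterm_val G e t = gterm_val G e' t"
    using FEq by (auto intro!: gterm_val_cong)
  then show ?case by simp
next
  case (FNeg \<phi>)
  then have "holds G e \<phi> \<longleftrightarrow> holds G e' \<phi>"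
    by (intro FNeg.IH) simp
  then show ?case by simp
next
  case (FConj \<phi> \<psi>)
  have "holds G e \<phi> \<longleftrightarrow> holds G e' \<phi>" "holds G e \<psi> \<longleftrightarrow> holds G e' \<psi>"
    using FConj.prems by (auto intro!: FConj.IH)
  then show ?case by simp
next
  case (FEx i \<phi>)
  have "holds G (e(i := a)) \<phi> \<longleftrightarrow> holds G (e'(i := a)) \<phi>" for a
    using FEx.prems by (intro FEx.IH) auto
  then show ?case by simp
qed

instance gterm :: countable
  by countable_datatype

instance gform :: countable
  by countable_datatype

section \<open>Skolem terms and their values\<close>

text \<open>These are names for sequences in the group. Closing under operations syntactically makes
  countability of the family immediate.\<close>

datatype 'a skolem_term = Const 'a | Mult "'a skolem_term" "'a skolem_term" | Inv "'a skolem_term"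
  | Pow "'a skolem_term" | Skolem nat gform "'a skolem_term list" | Fresh "'a skolem_term list"

instance skolem_term :: (countable) countable
  by countable_datatype

text \<open>Words are graded by the depth of a product tree instead of their length, so that a
  product costs one level. Levels over a finite set are finite.\<close>

primrec words :: "('a, 'm) monoid_scheme \<Rightarrow> 'a set \<Rightarrow> nat \<Rightarrow> 'a set" where
  "words F S 0 = insert \<one>\<^bsub>F\<^esub> (S \<union> m_inv F ` S)"
| "words F S (Suc m) = words F S m \<union> (\<lambda>(u, v). u \<otimes>\<^bsub>F\<^esub> v) ` (words F S m \<times> words F S m)"

lemma finite_words: "finite S \<Longrightarrow> finite (words F S m)"
  by (induction m) auto

lemma words_mono: "m \<le> n \<Longrightarrow> words F S m \<subseteq> words F S n"
  by (rule lift_Suc_mono_le[of "words F S"]) auto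

lemma mult_in_words:
  assumes "u \<in> words F S m" "v \<in> words F S n"
  shows "u \<otimes>\<^bsub>F\<^esub> v \<in> words F S (Suc (max m n))"
proof -
  have "u \<in> words F S (max m n)" "v \<in> words F S (max m n)"
    using assms words_mono[of m "max m n" F S] words_mono[of n "max m n" F S] by auto
  then show ?thesis by force
qed

definition list_env :: "('a, 'm) monoid_scheme \<Rightarrow> 'a list \<Rightarrow> nat \<Rightarrow> 'a" where
  "list_env F xs j = (if j < length xs then xs ! j else \<one>\<^bsub>F\<^esub>)"

text \<open>The index \<open>n\<close> enters as exponent in \<open>Pow\<close> and as word level in
  \<open>Fresh\<close>; both outgrow any constant along \<open>U\<close>. The default
  \<open>\<one>\<close> for \<open>Const\<close> and \<open>Skolem\<close> keeps values in the
  carrier.\<close>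

primrec eval :: "('a, 'm) monoid_scheme \<Rightarrow> nat \<Rightarrow> 'a skolem_term \<Rightarrow> 'a" where
  "eval F n (Const a) = (if a \<in> carrier F then a else \<one>\<^bsub>F\<^esub>)"
| "eval F n (Mult s t) = eval F n s \<otimes>\<^bsub>F\<^esub> eval F n t"
| "eval F n (Inv t) = inv\<^bsub>F\<^esub> eval F n t"
| "eval F n (Pow t) = eval F n t [^]\<^bsub>F\<^esub> n"
| "eval F n (Skolem i \<phi> ts) =
     (if \<exists>a\<in>carrier F. holds F ((list_env F (map (eval F n) ts))(i := a)) \<phi>
      then SOME a. a \<in> carrier F \<and> holds F ((list_env F (map (eval F n) ts))(i := a)) \<phi>
      else \<one>\<^bsub>F\<^esub>)"
| "eval F n (Fresh ts) =
     (SOME a. a \<in> carrier F \<and> a \<notin> words F (set (map (eval F n) ts)) n)"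

section \<open>The limit group\<close>

text \<open>\<open>decided\<close> is the ultrafilter property restricted to first-order statements
  about sequences named by Skolem terms.\<close>

locale skolem_limit = group F
  for F :: "('a::countable, 'm) monoid_scheme" (structure) +
  fixes U :: "nat filter"
  assumes infinite: "infinite (carrier F)"
    and U_le: "U \<le> sequentially" and U_bot: "U \<noteq> bot"
    and decided: "eventually (\<lambda>n. holds F (list_env F (map (eval F n) ts)) \<phi>) U \<or>
      eventually (\<lambda>n. \<not> holds F (list_env F (map (eval F n) ts)) \<phi>) U"
begin

lemma eval_Skolem:
  assumes "a \<in> carrier F" "holds F ((list_env F (map (eval F n) ts))(i := a)) \<phi>"
  shows "holds F ((list_env F (map (eval F n) ts))(i := eval F n (Skolem i \<phi> ts))) \<phi>"
proof -
  have "\<exists>a. a \<in> carrier F \<and> holds F ((list_env F (map (eval F n) ts))(i := a)) \<phi>"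
    using assms by blast
  from someI_ex[OF this] show ?thesis
    using assms by auto
qed

lemma eval_Fresh: "eval F n (Fresh ts) \<in> carrier F - words F (set (map (eval F n) ts)) n"
proof -
  have "\<exists>a. a \<in> carrier F \<and> a \<notin> words F (set (map (eval F n) ts)) n"
    using infinite finite_words[of "set (map (eval F n) ts)" F n]
    by (metis List.finite_set finite_subset subsetI)
  from someI_ex[OF this] show ?thesis
    by simp
qed

lemma eval_closed [simp]: "eval F n t \<in> carrier F"
proof (induction t)
  case (Skolem i \<phi> ts)
  show ?case
  proof (cases "\<exists>a. a \<in> carrier F \<and> holds F ((list_env F (map (eval F n) ts))(i := a)) \<phi>")
    case True
    from someI_ex[OF this] show ?thesis by auto
  qed auto
next
  case (Fresh ts)
  then show ?case using eval_Fresh by blast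
qed (auto simp del: eval.simps(5,6))

definition sim :: "'a skolem_term \<Rightarrow> 'a skolem_term \<Rightarrow> bool" where
  "sim s t \<longleftrightarrow> eventually (\<lambda>n. eval F n s = eval F n t) U"

text \<open>A class is encoded by the least code of a member, so \<open>from_nat\<close> recovers a
  representative and the limit lives on the natural numbers.\<close>

definition cls :: "'a skolem_term \<Rightarrow> nat" where
  "cls t = (LEAST k. sim (from_nat k) t)"

definition limit :: "nat monoid" where
  "limit = \<lparr>carrier = range cls,
     monoid.mult = (\<lambda>i j. cls (Mult (from_nat i) (from_nat j))),
     one = cls (Const \<one>)\<rparr>"

lemma sim_refl: "sim t t"
  by (simp add: sim_def)

lemma sim_cls: "sim (from_nat (cls t)) t"
  unfolding cls_def by (rule LeastI[of "\<lambda>k. sim (from_nat k) t" "to_nat t"]) (simp add: sim_refl)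

lemma cls_eq_iff: "cls s = cls t \<longleftrightarrow> sim s t"
proof
  assume eq: "cls s = cls t"
  show "sim s t"
    using sim_cls[of s] sim_cls[of t] unfolding eq sim_def by eventually_elim simp
next
  assume st: "sim s t"
  have "sim r s \<longleftrightarrow> sim r t" for r
  proof
    assume "sim r s"
    with st show "sim r t" unfolding sim_def by eventually_elim simp
  next
    assume "sim r t"
    with st show "sim r s" unfolding sim_def by eventually_elim simp
  qed
  then show "cls s = cls t" by (simp only: cls_def)
qed

lemma cls_eqI: "(\<And>n. eval F n s = eval F n t) \<Longrightarrow> cls s = cls t"
  by (simp add: cls_eq_iff sim_def)

lemma carrier_limit [simp]: "carrier limit = range cls"
  by (simp add: limit_def)

lemma one_limit: "\<one>\<^bsub>limit\<^esub> = cls (Const \<one>)"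
  by (simp add: limit_def)

lemma mult_limit [simp]: "cls s \<otimes>\<^bsub>limit\<^esub> cls t = cls (Mult s t)"
proof -
  have "eventually (\<lambda>n. eval F n (Mult (from_nat (cls s)) (from_nat (cls t))) = eval F n (Mult s t)) U"
    using sim_cls[of s] sim_cls[of t] unfolding sim_def by eventually_elim simp
  then show ?thesis
    by (simp add: limit_def cls_eq_iff sim_def)
qed

lemma group_limit: "group limit"
proof (rule groupI)
  fix x assume "x \<in> carrier limit"
  then obtain t where "x = cls t" by auto
  then show "\<exists>y\<in>carrier limit. y \<otimes>\<^bsub>limit\<^esub> x = \<one>\<^bsub>limit\<^esub>"
    by (intro bexI[of _ "cls (Inv t)"]) (auto simp: one_limit intro: cls_eqI)
qed (auto simp: one_limit m_assoc intro!: cls_eqI)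

lemma inv_limit: "inv\<^bsub>limit\<^esub> (cls t) = cls (Inv t)"
  by (rule group.inv_equality[OF group_limit]) (auto simp: one_limit intro: cls_eqI)

primrec subst :: "(nat \<Rightarrow> 'a skolem_term) \<Rightarrow> gterm \<Rightarrow> 'a skolem_term" where
  "subst e (TVar i) = e i"
| "subst e TOne = Const \<one>"
| "subst e (TMult s t) = Mult (subst e s) (subst e t)"
| "subst e (TInv t) = Inv (subst e t)"

lemma gterm_val_limit: "gterm_val limit (cls \<circ> e) s = cls (subst e s)"
  by (induction s) (auto simp: one_limit inv_limit)

lemma eval_subst: "eval F n (subst e s) = gterm_val F (\<lambda>j. eval F n (e j)) s"
  by (induction s) auto

lemma holds_list_env:
  "holds F ((list_env F (map (eval F n) (map e [0..<form_bound \<phi>])))(i := a)) \<phi> \<longleftrightarrow>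
   holds F ((\<lambda>j. eval F n (e j))(i := a)) \<phi>"
  by (rule holds_cong) (auto simp: list_env_def)

lemma decided_holds:
  "eventually (\<lambda>n. holds F (\<lambda>j. eval F n (e j)) \<phi>) U \<or>
   eventually (\<lambda>n. \<not> holds F (\<lambda>j. eval F n (e j)) \<phi>) U"
proof -
  have "holds F (list_env F (map (eval F n) (map e [0..<form_bound \<phi>]))) \<phi> \<longleftrightarrow>
      holds F (\<lambda>j. eval F n (e j)) \<phi>" for n
    by (rule holds_cong) (auto simp: list_env_def)
  then show ?thesis
    using decided[of "map e [0..<form_bound \<phi>]" \<phi>] by simp
qed

section \<open>Los's theorem and the elementary embedding\<close>

text \<open>This is the analogue of Los's theorem. Negation relies on \<open>decided\<close> and
  \<open>U_bot\<close>; for the existential quantifier, a Skolem term picks witnesses at all indices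
  simultaneously.\<close>

theorem holds_limit_iff:
  "holds limit (cls \<circ> e) \<phi> \<longleftrightarrow> eventually (\<lambda>n. holds F (\<lambda>j. eval F n (e j)) \<phi>) U"
proof (induction \<phi> arbitrary: e)
  case (FEq s t)
  show ?case
    by (simp only: holds.simps gterm_val_limit cls_eq_iff sim_def eval_subst)
next
  case (FNeg \<phi>)
  have "\<not> (eventually (\<lambda>n. holds F (\<lambda>j. eval F n (e j)) \<phi>) U \<and>
      eventually (\<lambda>n. \<not> holds F (\<lambda>j. eval F n (e j)) \<phi>) U)"
    using eventually_conj[of _ U] U_bot by (fastforce simp: trivial_limit_def)
  then show ?case
    using FNeg decided_holds[of e \<phi>] by auto
next
  case (FConj \<phi> \<psi>)
  then show ?case by (simp add: eventually_conj_iff)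
next
  case (FEx i \<phi>)
  have upd: "(\<lambda>j. eval F n ((e(i := s)) j)) = (\<lambda>j. eval F n (e j))(i := eval F n s)" for n s
    by auto
  have "holds limit (cls \<circ> e) (FEx i \<phi>) \<longleftrightarrow> (\<exists>s. holds limit (cls \<circ> (e(i := s))) \<phi>)"
    by (simp add: fun_upd_comp)
  also have "\<dots> \<longleftrightarrow> (\<exists>s. eventually (\<lambda>n. holds F ((\<lambda>j. eval F n (e j))(i := eval F n s)) \<phi>) U)"
    by (simp only: FEx.IH upd)
  also have "\<dots> \<longleftrightarrow> eventually (\<lambda>n. holds F (\<lambda>j. eval F n (e j)) (FEx i \<phi>)) U"
  proof
    assume "\<exists>s. eventually (\<lambda>n. holds F ((\<lambda>j. eval F n (e j))(i := eval F n s)) \<phi>) U"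
    then obtain s where "eventually (\<lambda>n. holds F ((\<lambda>j. eval F n (e j))(i := eval F n s)) \<phi>) U"
      by blast
    then show "eventually (\<lambda>n. holds F (\<lambda>j. eval F n (e j)) (FEx i \<phi>)) U"
      by eventually_elim (use eval_closed in auto)
  next
    define s where "s = Skolem i \<phi> (map e [0..<form_bound \<phi>])"
    assume "eventually (\<lambda>n. holds F (\<lambda>j. eval F n (e j)) (FEx i \<phi>)) U"
    then have "eventually (\<lambda>n. holds F ((\<lambda>j. eval F n (e j))(i := eval F n s)) \<phi>) U"
    proof eventually_elim
      case (elim n)
      then obtain a where "a \<in> carrier F" "holds F ((\<lambda>j. eval F n (e j))(i := a)) \<phi>"
        by auto
      then show ?case
        using eval_Skolem[of a n "map e [0..<form_bound \<phi>]" i \<phi>]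
        unfolding holds_list_env s_def by blast
    qed
    then show "\<exists>s. eventually (\<lambda>n. holds F ((\<lambda>j. eval F n (e j))(i := eval F n s)) \<phi>) U"
      by blast
  qed
  finally show ?case .
qed

text \<open>Parameters from \<open>F\<close> are constant sequences, for which the statement under
  \<open>eventually\<close> does not depend on the index, and \<open>U\<close> is
  nontrivial.\<close>

theorem elementary_embedding_limit: "elementary_embedding F limit (\<lambda>w. cls (Const w))"
  unfolding elementary_embedding_def
proof (intro conjI allI impI)
  have "x = y" if "x \<in> carrier F" "y \<in> carrier F" "cls (Const x) = cls (Const y)" for x y
    using that U_bot by (simp add: cls_eq_iff sim_def)
  then show "(\<lambda>w. cls (Const w)) \<in> mon F limit"
    by (auto simp: mon_def hom_def inj_on_def intro!: cls_eqI)
next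
  fix \<phi> and e :: "nat \<Rightarrow> 'a" assume "range e \<subseteq> carrier F"
  then have "eval F n (Const (e j)) = e j" for n j
    by auto
  then have "holds limit (cls \<circ> (\<lambda>j. Const (e j))) \<phi> \<longleftrightarrow> holds F e \<phi>"
    unfolding holds_limit_iff using U_bot by (simp del: eval.simps)
  then show "holds F e \<phi> = holds limit ((\<lambda>w. cls (Const w)) \<circ> e) \<phi>"
    by (simp add: o_def)
qed

section \<open>Failure of finite generation\<close>

theorem not_finitely_generated_limit: "\<not> finitely_generated limit"
proof
  assume "finitely_generated limit"
  then obtain S where S: "finite S" "S \<subseteq> range cls" "generate limit S = range cls"
    by (auto simp: finitely_generated_def)
  then obtain T where "finite T" "S = cls ` T"
    using finite_subset_image by metis
  then obtain ts where ts: "S = cls ` set ts"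
    using finite_list by metis
  define W where "W = (\<lambda>n. words F (set (map (eval F n) ts)))"
  \<comment> \<open>Every generated element has a representative whose values stay in one level
    \<open>m\<close> at all indices. \<open>Fresh ts\<close> avoids level \<open>n\<close> at index
    \<open>n\<close>, hence level \<open>m\<close> once \<open>n\<close> is at least
    \<open>m\<close>.\<close>
  have gen: "\<exists>s m. g = cls s \<and> (\<forall>n. eval F n s \<in> W n m)" if "g \<in> generate limit S" for g
    using that
  proof (induction rule: generate.induct)
    case one
    show ?case
      by (rule exI[of _ "Const \<one>"], rule exI[of _ 0]) (simp add: one_limit W_def)
  next
    case (incl h)
    then obtain t where "t \<in> set ts" "h = cls t" by (auto simp: ts)
    then show ?case
      by (intro exI[of _ t] exI[of _ 0]) (auto simp: W_def)
  next
    case (inv h)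
    then obtain t where "t \<in> set ts" "h = cls t" by (auto simp: ts)
    then show ?case
      by (intro exI[of _ "Inv t"] exI[of _ 0]) (auto simp: W_def inv_limit)
  next
    case (eng g h)
    then obtain s m t k where "g = cls s" "\<forall>n. eval F n s \<in> W n m" "h = cls t" "\<forall>n. eval F n t \<in> W n k"
      by blast
    then show ?case
      by (intro exI[of _ "Mult s t"] exI[of _ "Suc (max m k)"])
        (auto simp: W_def simp del: words.simps intro!: mult_in_words)
  qed
  obtain s m where s: "cls (Fresh ts) = cls s" "\<And>n. eval F n s \<in> W n m"
    using gen[of "cls (Fresh ts)"] S(3) by blast
  have "eventually (\<lambda>n. m \<le> n) U"
    using U_le eventually_ge_at_top by (rule filter_leD)
  moreover have "eventually (\<lambda>n. eval F n (Fresh ts) = eval F n s) U"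
    using s(1) by (simp add: cls_eq_iff sim_def)
  ultimately have "eventually (\<lambda>n. False) U"
  proof eventually_elim
    case (elim n)
    then show False
      using s(2)[of n] eval_Fresh[of n ts] words_mono[of m n F "set (map (eval F n) ts)"]
      by (auto simp: W_def)
  qed
  then show False
    using U_bot by simp
qed

section \<open>Powers and commuting partners in the limit\<close>

text \<open>This allows computing in the limit with coordinate sequences, such as those of integer
  powers, without writing a term for each.\<close>

definition represents :: "nat \<Rightarrow> (nat \<Rightarrow> 'a) \<Rightarrow> bool" where
  "represents g x \<longleftrightarrow> (\<exists>t. g = cls t \<and> eventually (\<lambda>n. eval F n t = x n) U)"

lemma represents_cls: "represents (cls t) (\<lambda>n. eval F n t)"
  by (auto simp: represents_def)

lemma represents_unique:
  assumes "represents g x" "represents g y"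
  shows "eventually (\<lambda>n. x n = y n) U"
proof -
  obtain s t where "cls s = cls t" and st: "eventually (\<lambda>n. eval F n s = x n) U"
      "eventually (\<lambda>n. eval F n t = y n) U"
    using assms by (auto simp: represents_def)
  then have "eventually (\<lambda>n. eval F n s = eval F n t) U"
    by (simp add: cls_eq_iff sim_def)
  with st show ?thesis by eventually_elim simp
qed

lemma represents_mult:
  assumes "represents g x" "represents h y"
  shows "represents (g \<otimes>\<^bsub>limit\<^esub> h) (\<lambda>n. x n \<otimes> y n)"
proof -
  obtain s t where eq: "g = cls s" "h = cls t" and st: "eventually (\<lambda>n. eval F n s = x n) U"
      "eventually (\<lambda>n. eval F n t = y n) U"
    using assms by (auto simp: represents_def)
  from st have "eventually (\<lambda>n. eval F n (Mult s t) = x n \<otimes> y n) U"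
    by eventually_elim simp
  then show ?thesis
    unfolding represents_def eq mult_limit by blast
qed

lemma represents_inv:
  assumes "represents g x"
  shows "represents (inv\<^bsub>limit\<^esub> g) (\<lambda>n. inv (x n))"
proof -
  obtain s where eq: "g = cls s" and st: "eventually (\<lambda>n. eval F n s = x n) U"
    using assms by (auto simp: represents_def)
  from st have "eventually (\<lambda>n. eval F n (Inv s) = inv (x n)) U"
    by eventually_elim simp
  then show ?thesis
    unfolding represents_def eq inv_limit by blast
qed

lemma represents_nat_pow:
  assumes "represents g x"
  shows "represents (g [^]\<^bsub>limit\<^esub> (k::nat)) (\<lambda>n. x n [^] k)"
proof (induction k)
  case 0
  show ?case using represents_cls[of "Const \<one>"] by (simp add: one_limit)
next
  case (Suc k)
  then show ?case using represents_mult[OF Suc assms] by simp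
qed

lemma represents_int_pow:
  assumes "represents g x"
  shows "represents (g [^]\<^bsub>limit\<^esub> (a::int)) (\<lambda>n. x n [^] a)"
  unfolding int_pow_def2
  by (cases "a < 0")
    (simp_all only: if_True if_False represents_inv represents_nat_pow assms)

text \<open>The partner is \<open>cls (Pow t)\<close> for \<open>g = cls t\<close>. If its
  \<open>m\<close>-th power were the \<open>a\<close>-th power of \<open>g\<close>, the values of
  \<open>t\<close> would eventually satisfy \<open>x [^] (n * m - a) = \<one>\<close>. This exponent
  is positive once \<open>n\<close> exceeds the absolute value of \<open>a\<close>, so
  torsion-freeness would make \<open>g\<close> trivial.\<close>

lemma power_independent_centralizer:
  assumes torsion_free: "\<And>x n. x \<in> carrier F \<Longrightarrow> x [^] (n::nat) = \<one> \<Longrightarrow> n > 0 \<Longrightarrow> x = \<one>"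
    and g: "g \<in> carrier limit" "g \<noteq> \<one>\<^bsub>limit\<^esub>"
  shows "\<exists>h\<in>carrier limit. h \<otimes>\<^bsub>limit\<^esub> g = g \<otimes>\<^bsub>limit\<^esub> h \<and>
    (\<forall>m a. m > 0 \<longrightarrow> h [^]\<^bsub>limit\<^esub> (m::nat) \<noteq> g [^]\<^bsub>limit\<^esub> (a::int))"
proof -
  obtain t where t: "g = cls t" using g by auto
  have "cls (Pow t) [^]\<^bsub>limit\<^esub> m \<noteq> g [^]\<^bsub>limit\<^esub> a" if m: "m > 0" for m :: nat and a :: int
  proof
    assume "cls (Pow t) [^]\<^bsub>limit\<^esub> m = g [^]\<^bsub>limit\<^esub> a"
    then have "eventually (\<lambda>n. eval F n (Pow t) [^] m = eval F n t [^] a) U"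
      using represents_nat_pow[OF represents_cls[of "Pow t"], of m]
        represents_int_pow[OF represents_cls[of t], of a] represents_unique by (metis t)
    moreover have "eventually (\<lambda>n. nat \<bar>a\<bar> < n) U"
      using U_le eventually_gt_at_top by (rule filter_leD)
    ultimately have "eventually (\<lambda>n. eval F n t = eval F n (Const \<one>)) U"
    proof eventually_elim
      case (elim n)
      define x where "x = eval F n t"
      have x: "x \<in> carrier F" by (simp add: x_def)
      have "n * 1 \<le> n * m"
        using m by (intro mult_le_mono2) simp
      then have "int n \<le> int (n * m)"
        by (simp only: of_nat_le_iff mult_1_right)
      then have pos: "int (n * m) - a > 0"
        using elim(2) by linarith
      have "x [^] int (n * m) = x [^] a"
        unfolding int_pow_int using elim(1) x by (simp add: x_def nat_pow_pow)
      then have "x [^] (int (n * m) - a) = \<one>"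
        using x by (simp only: int_pow_diff) simp
      moreover obtain j where "int (n * m) - a = int j" "j > 0"
        using pos zero_less_imp_eq_int by blast
      ultimately have "x [^] j = \<one>"
        by (metis int_pow_int)
      then have "x = \<one>"
        using torsion_free[OF x] \<open>j > 0\<close> by simp
      then show ?case by (simp add: x_def)
    qed
    then show False
      using g(2) by (simp add: t one_limit cls_eq_iff sim_def del: eval.simps)
  qed
  moreover have "cls (Pow t) \<otimes>\<^bsub>limit\<^esub> g = g \<otimes>\<^bsub>limit\<^esub> cls (Pow t)"
    unfolding t mult_limit
  proof (rule cls_eqI)
    show "eval F n (Mult (Pow t) t) = eval F n (Mult t (Pow t))" for n
      using nat_pow_Suc2[of "eval F n t" n] by simp
  qed
  ultimately show ?thesis
    by (intro bexI[of _ "cls (Pow t)"]) auto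
qed

end

section \<open>Elementary extensions of torsion-free groups\<close>

lemma (in skolem_limit) not_acylindrically_hyperbolic_limit:
  assumes torsion_free: "\<And>x n. x \<in> carrier F \<Longrightarrow> x [^] (n::nat) = \<one> \<Longrightarrow> n > 0 \<Longrightarrow> x = \<one>"
  shows "\<not> acylindrically_hyperbolic limit"
proof
  assume "acylindrically_hyperbolic limit"
  then obtain X :: "(nat \<times> real) set" and d \<phi> g
    where hyp: "hyperbolic_space X d" and acyl: "acylindrical_action limit X d \<phi>"
      and lox: "loxodromic limit X d \<phi> g"
    unfolding acylindrically_hyperbolic_def acylindrically_hyperbolic_action_def by blast
  interpret L: group limit by (rule group_limit)
  have "g \<in> carrier limit"
    using lox unfolding loxodromic_def by (rule conjunct1)
  moreover have "g \<noteq> \<one>\<^bsub>limit\<^esub>"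
  proof (rule loxodromic_neq_one[OF _ lox group_limit])
    show "Metric_space X d"
      using hyp unfolding hyperbolic_space_def by (rule conjunct1)
  qed
  ultimately obtain h where h: "h \<in> carrier limit" "h \<otimes>\<^bsub>limit\<^esub> g = g \<otimes>\<^bsub>limit\<^esub> h"
    and "\<forall>m a. m > 0 \<longrightarrow> h [^]\<^bsub>limit\<^esub> (m::nat) \<noteq> g [^]\<^bsub>limit\<^esub> (a::int)"
    using power_independent_centralizer[of g] torsion_free by blast
  with L.centralizer_power_loxodromic[OF hyp acyl lox h] show False
    by blast
qed

theorem ex_elementary_extension_not_acylindrically_hyperbolic:
  fixes F :: "('a::countable, 'm) monoid_scheme" (structure)
  assumes "group F" "infinite (carrier F)"
    and torsion_free: "\<And>x n. x \<in> carrier F \<Longrightarrow> x [^] (n::nat) = \<one> \<Longrightarrow> n > 0 \<Longrightarrow> x = \<one>"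
  shows "\<exists>(G :: nat monoid) f. group G \<and> \<not> finitely_generated G \<and>
    \<not> acylindrically_hyperbolic G \<and> elementary_embedding F G f"
proof -
  \<comment> \<open>A formula together with its Skolem parameters belongs to a countable type, so
    all instances can be enumerated and decided by one filter.\<close>
  define P where "P = (\<lambda>(\<phi>, ts) n. holds F (list_env F (map (eval F n) ts)) \<phi>)"
  obtain U where U: "U \<le> sequentially" "U \<noteq> bot"
    and dec: "\<And>k. eventually (P (from_nat k)) U \<or> eventually (\<lambda>n. \<not> P (from_nat k) n) U"
    using ex_deciding_filter[of "\<lambda>k. P (from_nat k)"] by blast
  have "eventually (P (\<phi>, ts)) U \<or> eventually (\<lambda>n. \<not> P (\<phi>, ts) n) U" for \<phi> ts
    using dec[of "to_nat (\<phi>, ts)"] by (simp only: from_nat_to_nat)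
  then interpret skolem_limit F U
    using assms U by (simp add: skolem_limit_def skolem_limit_axioms_def P_def)
  have "\<not> acylindrically_hyperbolic limit"
    by (rule not_acylindrically_hyperbolic_limit) (rule torsion_free)
  then show ?thesis
    using group_limit not_finitely_generated_limit elementary_embedding_limit by blast
qed

section \<open>Free groups are torsion-free\<close>

lemma (in group) nat_pow_conjugate:
  assumes "a \<in> carrier G" "v \<in> carrier G"
  shows "(inv a \<otimes> v \<otimes> a) [^] (k::nat) = inv a \<otimes> v [^] k \<otimes> a"
proof (induction k)
  case (Suc k)
  have "a \<otimes> (inv a \<otimes> (v \<otimes> a)) = v \<otimes> a"
    using assms by (simp flip: m_assoc)
  then show ?case
    using assms Suc by (simp add: m_assoc)
qed (use assms in simp)

lemma (in group) conjugate_eq_one: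
  assumes "a \<in> carrier G" "v \<in> carrier G" "inv a \<otimes> v \<otimes> a = \<one>"
  shows "v = \<one>"
proof -
  have "v = a \<otimes> (inv a \<otimes> v \<otimes> a) \<otimes> inv a"
    using assms(1,2) by (simp add: m_assoc) (simp flip: m_assoc add: assms(1,2))
  also have "\<dots> = \<one>"
    unfolding assms(3) using assms(1) by simp
  finally show ?thesis .
qed

lemma infinite_free_group:
  assumes "a \<in> S" shows "infinite (carrier (free_group S))"
proof -
  have "reduced (replicate n (a, True))" for n
    by (induction n rule: nat_induct) (auto simp: reduced_def successively_Cons inv_letter_def)
  then have "range (\<lambda>n. replicate n (a, True)) \<subseteq> carrier (free_group S)"
    using assms by (auto simp: free_group_def)
  moreover have "inj (\<lambda>n. replicate n (a, True))"
    by (rule injI) (metis length_replicate)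
  ultimately show ?thesis
    using finite_subset finite_imageD by blast
qed

lemma free_group_mult_append:
  assumes "reduced (u @ v)"
  shows "u \<otimes>\<^bsub>free_group S\<^esub> v = u @ v"
proof -
  have "reduced v"
    using assms by (simp add: reduced_def successively_append_iff)
  then show ?thesis
    using foldr_push_Nil[OF assms] by (simp add: free_group_def foldr_push_Nil)
qed

text \<open>Cyclic reduction: if the first and the last letter of a word do not cancel then its powers are
  obtained by concatenation, and otherwise the word is conjugate to a shorter one.\<close>

theorem free_group_torsion_free:
  assumes "w \<in> carrier (free_group S)" "w [^]\<^bsub>free_group S\<^esub> (k::nat) = \<one>\<^bsub>free_group S\<^esub>" "k > 0"
  shows "w = \<one>\<^bsub>free_group S\<^esub>"
  using assms(1,2)
proof (induction "length w" arbitrary: w rule: less_induct)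
  case less
  interpret group "free_group S" by (rule group_free_group)
  have one: "\<one>\<^bsub>free_group S\<^esub> = []" by (simp add: free_group_def)
  show ?case
  proof (rule ccontr)
    assume "w \<noteq> \<one>\<^bsub>free_group S\<^esub>"
    then have ne: "w \<noteq> []" by (simp add: one)
    have red: "reduced w" using less.prems(1) by (simp add: free_group_def)
    show False
    proof (cases "hd w = inv_letter (last w)")
      case False
      \<comment> \<open>Tracking the first letter of the power keeps the induction going: the next
        junction joins \<open>last w\<close> to \<open>hd w\<close>, which do not cancel.\<close>
      have "reduced (w [^]\<^bsub>free_group S\<^esub> n) \<and> (n > 0 \<longrightarrow> w [^]\<^bsub>free_group S\<^esub> n \<noteq> [] \<and> hd (w [^]\<^bsub>free_group S\<^esub> n) = hd w)"
        for n :: nat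
      proof (induction n)
        case 0
        then show ?case by (simp add: one)
      next
        case (Suc n)
        define v where "v = w [^]\<^bsub>free_group S\<^esub> n"
        have v: "v = [] \<or> hd v = hd w" "reduced v"
          using Suc by (cases "n = 0"; simp add: v_def one)+
        have "reduced (w @ v)"
          using v red False ne by (auto simp: reduced_def successively_append_iff)
        moreover have "w [^]\<^bsub>free_group S\<^esub> Suc n = w \<otimes>\<^bsub>free_group S\<^esub> v"
          using less.prems(1) unfolding v_def by (rule nat_pow_Suc2)
        ultimately show ?case
          using ne by (simp add: free_group_mult_append)
      qed
      then show False
        using less.prems(2) \<open>k > 0\<close> by (metis one)
    next
      case True
      define x where "x = last w"
      \<comment> \<open>No letter is its own inverse.\<close>
      have "length w \<noteq> 1"
        using True by (cases w) (auto simp: inv_letter_def prod_eq_iff)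
      then obtain v where w: "w = inv_letter x # v @ [x]"
        using ne True unfolding x_def by (cases w; cases "tl w" rule: rev_cases) auto
      \<comment> \<open>An empty \<open>v\<close> would put \<open>inv_letter x\<close> next to
        \<open>x\<close> in the reduced word \<open>w\<close>.\<close>
      have v: "v \<noteq> []" "reduced (inv_letter x # v)" "reduced v"
        using red unfolding w reduced_def
        by (auto simp: successively_append_iff successively_Cons)
      have carr: "[x] \<in> carrier (free_group S)" "v \<in> carrier (free_group S)" "[inv_letter x] \<in> carrier (free_group S)"
        using less.prems(1) v(3) by (auto simp: free_group_def w reduced_def)
      have "inv\<^bsub>free_group S\<^esub> [x] = [inv_letter x]"
        using carr by (intro inv_equality) (auto simp: free_group_def)
      moreover have "[inv_letter x] \<otimes>\<^bsub>free_group S\<^esub> v \<otimes>\<^bsub>free_group S\<^esub> [x] = w"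
        using free_group_mult_append[of "[inv_letter x]" v S] v
          free_group_mult_append[of "inv_letter x # v" "[x]" S] red by (simp add: w)
      ultimately have "inv\<^bsub>free_group S\<^esub> [x] \<otimes>\<^bsub>free_group S\<^esub> v [^]\<^bsub>free_group S\<^esub> k \<otimes>\<^bsub>free_group S\<^esub> [x] = \<one>\<^bsub>free_group S\<^esub>"
        using nat_pow_conjugate[of "[x]" v k] carr less.prems(2) by simp
      then have vk: "v [^]\<^bsub>free_group S\<^esub> k = \<one>\<^bsub>free_group S\<^esub>"
        using carr by (metis conjugate_eq_one nat_pow_closed)
      have "v = \<one>\<^bsub>free_group S\<^esub>"
        by (rule less.hyps[OF _ carr(2) vk]) (simp add: w)
      then show False
        using v(1) by (simp add: one)
    qed
  qed
qed

theorem mainTheorem5: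
  shows "\<exists>(G :: nat monoid) f.
           group G \<and> countable (carrier G) \<and>
           \<not> finitely_generated G \<and>
           \<not> acylindrically_hyperbolic G \<and>
           elementary_embedding free_group_2 G f"
proof -
  have "\<exists>(G :: nat monoid) f. group G \<and> \<not> finitely_generated G \<and>
      \<not> acylindrically_hyperbolic G \<and> elementary_embedding free_group_2 G f"
    unfolding free_group_2_def
  proof (rule ex_elementary_extension_not_acylindrically_hyperbolic)
    show "w = \<one>\<^bsub>free_group UNIV\<^esub>"
      if "w \<in> carrier (free_group UNIV)" "w [^]\<^bsub>free_group UNIV\<^esub> n = \<one>\<^bsub>free_group UNIV\<^esub>" "n > 0"
      for w :: "bool letter list" and n :: nat
      using that by (rule free_group_torsion_free)
  qed (simp_all add: group_free_group infinite_free_group[OF UNIV_I])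
  then show ?thesis
    by simp
qed

end
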